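(* Let $\Omega\subseteq\mathbb{R}^{d_1}$ be a bounded Lipschitz domain, $E\subseteq\partial\Omega$, $n\geqslant 1$, $(\lambda_d,\lambda_e)\in\mathbb{R}_+^2\setminus\{(0,0)\}$, $H\geqslant2$ and $D\geqslant1$. Assume that the condition function $h:E\to\mathbb{R}^{d_2}$ is Lipschitz and that $\mathscr{F}_1,\ldots,\mathscr{F}_M$ are polynomial operators. Let the ridge parameter be $$\lambda_{(\mathrm{ridge})}=\min(n_e,n_r)^{-\kappa},\qquad \kappa=\frac{1}{12+4H\big(1+(2+H)\max_k\deg(\mathscr{F}_k)\big)},$$ and for all $n_e,n_r$ let $(\hat\theta^{(\mathrm{ridge})}(p,n_e,n_r,D))_{p\in\mathbb{N}}$ be a minimizing sequence over $\Theta_{H,D}$ of the ridge empirical risk $R^{(\mathrm{ridge})}_{n,n_e,n_r}(u_\theta)=R_{n,n_e,n_r}(u_\theta)+\lambda_{(\mathrm{ridge})}\|\theta\|_2^2$. Then, almost surely, $$\lim_{n_e,n_r\to\infty}\ \lim_{p\to\infty}\mathscr{R}_n\big(u_{\hat\theta^{(\mathrm{ridge})}(p,n_e,n_r,D)}\big)=\inf_{u\in\mathrm{NN}_H(D)}\mathscr{R}_n(u).$$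
   Context: Data. $(X_1,Y_1),\ldots,(X_n,Y_n)$ are i.i.d. in $\Omega\times\mathbb{R}^{d_2}$ ($n$ is kept fixed); $X^{(e)},X^{(e)}_1,X^{(e)}_2,\ldots$ are i.i.d. with a known distribution $\mu_E$ on $E$; $X^{(r)}_1,X^{(r)}_2,\ldots$ are i.i.d. uniform on $\Omega$. The risks are $$R_{n,n_e,n_r}(u_\theta)=\frac{\lambda_d}{n}\sum_{i=1}^n\|u_\theta(X_i)-Y_i\|_2^2+\frac{\lambda_e}{n_e}\sum_{j=1}^{n_e}\|u_\theta(X^{(e)}_j)-h(X^{(e)}_j)\|_2^2+\frac1{n_r}\sum_{k=1}^M\sum_{\ell=1}^{n_r}\mathscr{F}_k(u_\theta,X^{(r)}_\ell)^2,$$ $$\mathscr{R}_n(u)=\frac{\lambda_d}{n}\sum_{i=1}^n\|u(X_i)-Y_i\|_2^2+\lambda_e\mathbb{E}\|u(X^{(e)})-h(X^{(e)})\|_2^2+\frac1{|\Omega|}\sum_{k=1}^M\int_\Omega\mathscr{F}_k(u,x)^2dx,$$ the expectation being with respect to $X^{(e)}\sim\mu_E$ only. Neural networks. $u_\theta=\mathcal{A}_{H+1}\circ(\tanh\circ\mathcal{A}_H)\circ\cdots\circ(\tanh\circ\mathcal{A}_1)$, where $\tanh$ is applied element-wise, $\mathcal{A}_k(x)=W_kx+b_k$ with $W_k\in\mathbb{R}^{L_k\times L_{k-1}}$, $b_k\in\mathbb{R}^{L_k}$, $L_0=d_1$, $L_1=\cdots=L_H=D$, $L_{H+1}=d_2$.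 The parameter is $\theta=(W_1,b_1,\ldots,W_{H+1},b_{H+1})$, $\Theta_{H,D}$ is the set of all such parameters, $\|\theta\|_2$ its Euclidean norm, and $\mathrm{NN}_H(D)=\{u_\theta:\theta\in\Theta_{H,D}\}$. Function spaces. $\|u\|_{C^K(\Omega)}=\max_{|\alpha|\leqslant K}\sup_{x\in\Omega}\|\partial^\alpha u(x)\|_\infty$. $C^\infty(\bar\Omega,\mathbb{R}^{d})$ is the space of continuous $u:\bar\Omega\to\mathbb{R}^{d}$ with $u|_\Omega\in C^\infty(\Omega,\mathbb{R}^d)$ and $\|u\|_{C^K(\Omega)}<\infty$ for all $K\in\mathbb{N}$. Polynomial operators. $\mathscr{F}:C^K(\bar\Omega,\mathbb{R}^{d_2})\times\Omega\to\mathbb{R}$ is a polynomial operator of order $K$ if there are $s\in\mathbb{N}$, multi-indices $\alpha_{i,j}\in\mathbb{N}^{d_1}$ with $|\alpha_{i,j}|\leqslant K$ ($1\leqslant i\leqslant d_2$, $1\leqslant j\leqslant s$), an integer $N(P)\geqslant1$, functions $\phi_1,\ldots,\phi_{N(P)}\in C^\infty(\bar\Omega,\mathbb{R})$ and exponents $I(i,j,r)\in\mathbb{N}$ with $$\mathscr{F}(u,x)=\sum_{r=1}^{N(P)}\phi_r(x)\prod_{i=1}^{d_2}\prod_{j=1}^s\big(\partial^{\alpha_{i,j}}u_i(x)\big)^{I(i,j,r)}.$$ Its degree is $\deg(\mathscr{F})=\max_{1\leqslant r\leqslant N(P)}\sum_{i=1}^{d_2}\sum_{j=1}^s(1+|\alpha_{i,j}|)I(i,j,r)$.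 A minimizing sequence of a risk is a sequence of parameters along which the risk converges, as $p\to\infty$, to its infimum over $\Theta_{H,D}$. The iterated limit is $L$ means: for every $\varepsilon>0$ there is $N$ such that for all $n_e,n_r\geqslant N$ there is $P$ such that for all $p\geqslant P$ the quantity is within $\varepsilon$ of $L$. *)

theory Defs
  imports "HOL-Probability.Probability"
begin

text \<open>Near each boundary point, in suitable cylindrical coordinates with axis \<open>\<nu>\<close>, the set lies
  strictly below the graph of a Lipschitz function \<open>g\<close> on the hyperplane orthogonal to \<open>\<nu>\<close>, and the
  boundary is that graph. A domain is a nonempty connected open set.\<close>

definition lipschitz_domain :: "(real ^ 'd::finite) set \<Rightarrow> bool" where
  "lipschitz_domain \<Omega> \<longleftrightarrow>
     open \<Omega> \<and> connected \<Omega> \<and> \<Omega> \<noteq> {} \<and>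
     (\<forall>p \<in> frontier \<Omega>. \<exists>\<nu> g L r h.
        norm \<nu> = 1 \<and> r > 0 \<and> h > 0 \<and>
        L-lipschitz_on {y. y \<bullet> \<nu> = 0} (g :: real ^ 'd \<Rightarrow> real) \<and>
        (\<forall>y. y \<bullet> \<nu> = 0 \<and> norm y < r \<longrightarrow> \<bar>g y\<bar> < h) \<and>
        (\<forall>y t. y \<bullet> \<nu> = 0 \<and> norm y < r \<and> \<bar>t\<bar> < h \<longrightarrow>
           (p + y + t *\<^sub>R \<nu> \<in> \<Omega> \<longleftrightarrow> t < g y) \<and>
           (p + y + t *\<^sub>R \<nu> \<in> frontier \<Omega> \<longleftrightarrow> t = g y)))"

definition partial_deriv ::
    "'d::finite \<Rightarrow> (real ^ 'd \<Rightarrow> 'b::real_normed_vector) \<Rightarrow> real ^ 'd \<Rightarrow> 'b" where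
  "partial_deriv i f x = vector_derivative (\<lambda>t. f (x + t *\<^sub>R axis i 1)) (at 0)"

text \<open>A multi-index is a function from coordinates to exponents. The operator
  \<open>\<partial>\<^sup>\<alpha> = \<partial>\<^sub>1\<^sup>\<alpha>\<^sup>1 \<dots> \<partial>\<^sub>d\<^sup>\<alpha>\<^sup>d\<close> is formed along one fixed enumeration of the (unordered) coordinate type; on
  the functions to which it is applied, which have enough continuous derivatives, the order is
  irrelevant.\<close>

definition coords :: "'d::finite list" where
  "coords = (SOME xs. distinct xs \<and> set xs = UNIV)"

definition mi_order :: "('d::finite \<Rightarrow> nat) \<Rightarrow> nat" where
  "mi_order \<alpha> = (\<Sum>i\<in>UNIV. \<alpha> i)"

definition multi_deriv ::
    "('d::finite \<Rightarrow> nat) \<Rightarrow> (real ^ 'd \<Rightarrow> 'b::real_normed_vector) \<Rightarrow> real ^ 'd \<Rightarrow> 'b" where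
  "multi_deriv \<alpha> f = foldr (\<lambda>i. partial_deriv i ^^ \<alpha> i) coords f"

text \<open>The class \<open>C\<^sup>K(S)\<close> for an open set \<open>S\<close>: all iterated partial derivatives of order up to \<open>K\<close>
  exist and are continuous on \<open>S\<close>.\<close>

primrec Ck_on ::
    "nat \<Rightarrow> (real ^ 'd::finite) set \<Rightarrow> (real ^ 'd \<Rightarrow> 'b::real_normed_vector) \<Rightarrow> bool" where
  "Ck_on 0 S f \<longleftrightarrow> continuous_on S f"
| "Ck_on (Suc K) S f \<longleftrightarrow> continuous_on S f \<and>
     (\<forall>i. (\<forall>x\<in>S. (\<lambda>t. f (x + t *\<^sub>R axis i 1)) differentiable (at (0::real))) \<and>
          Ck_on K S (partial_deriv i f))"

definition Ck_norm ::
    "nat \<Rightarrow> (real ^ 'd::finite) set \<Rightarrow> (real ^ 'd \<Rightarrow> 'b::euclidean_space) \<Rightarrow> ennreal" where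
  "Ck_norm K \<Omega> u =
     (SUP \<alpha> \<in> {\<alpha>. mi_order \<alpha> \<le> K}. SUP x \<in> \<Omega>. ennreal (infnorm (multi_deriv \<alpha> u x)))"

text \<open>The spaces \<open>C\<^sup>K\<close> and \<open>C\<^sup>\<infinity>\<close> of the closure of \<open>\<Omega>\<close>. Their elements are represented by total
  functions, of which only the values on the closure of \<open>\<Omega>\<close> matter.\<close>

definition Ck_closure ::
    "nat \<Rightarrow> (real ^ 'd::finite) set \<Rightarrow> (real ^ 'd \<Rightarrow> 'b::euclidean_space) \<Rightarrow> bool" where
  "Ck_closure K \<Omega> u \<longleftrightarrow> continuous_on (closure \<Omega>) u \<and> Ck_on K \<Omega> u \<and> Ck_norm K \<Omega> u < \<infinity>"

definition Cinf_closure ::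
    "(real ^ 'd::finite) set \<Rightarrow> (real ^ 'd \<Rightarrow> 'b::euclidean_space) \<Rightarrow> bool" where
  "Cinf_closure \<Omega> u \<longleftrightarrow>
     continuous_on (closure \<Omega>) u \<and> (\<forall>K. Ck_on K \<Omega> u) \<and> (\<forall>K. Ck_norm K \<Omega> u < \<infinity>)"

text \<open>\<open>polynomial_operator \<Omega> K \<F> d\<close>: the operator \<open>\<F>\<close> is polynomial of order \<open>K\<close>, with degree \<open>d\<close>. Since
  the degree is read off a representation of \<open>\<F>\<close>, which need not be unique, it is an argument
  of the predicate instead of a function of \<open>\<F>\<close>: every representation of \<open>\<F>\<close> contributes its
  degree. The indices \<open>j\<close> and \<open>r\<close> start from 0. Nothing is required of \<open>\<F> u x\<close> unless \<open>u\<close> belongs to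
  \<open>C\<^sup>K\<close> of the closure and \<open>x \<in> \<Omega>\<close>.\<close>

definition polynomial_operator ::
    "(real ^ 'd1::finite) set \<Rightarrow> nat \<Rightarrow>
     ((real ^ 'd1 \<Rightarrow> real ^ 'd2::finite) \<Rightarrow> real ^ 'd1 \<Rightarrow> real) \<Rightarrow> nat \<Rightarrow> bool" where
  "polynomial_operator \<Omega> K \<F> d \<longleftrightarrow>
     (\<exists>(s::nat) (\<alpha> :: 'd2 \<Rightarrow> nat \<Rightarrow> 'd1 \<Rightarrow> nat) (N::nat) (\<phi> :: nat \<Rightarrow> real ^ 'd1 \<Rightarrow> real)
        (I :: 'd2 \<Rightarrow> nat \<Rightarrow> nat \<Rightarrow> nat).
        (\<forall>i. \<forall>j<s. mi_order (\<alpha> i j) \<le> K) \<and>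
        N \<ge> 1 \<and>
        (\<forall>r<N. Cinf_closure \<Omega> (\<phi> r)) \<and>
        (\<forall>u x. Ck_closure K \<Omega> u \<and> x \<in> \<Omega> \<longrightarrow>
           \<F> u x = (\<Sum>r<N. \<phi> r x *
             (\<Prod>i\<in>UNIV. \<Prod>j<s. (multi_deriv (\<alpha> i j) (\<lambda>y. u y $ i) x) ^ I i j r))) \<and>
        d = Max ((\<lambda>r. \<Sum>i\<in>UNIV. \<Sum>j<s. (1 + mi_order (\<alpha> i j)) * I i j r) ` {..<N}))"

text \<open>A layer is a pair of a weight matrix and a bias vector, with rows indexed by the output. The
  width \<open>D\<close> of the hidden layers is the cardinality of the type \<open>'w\<close>. A parameter consists of the
  first layer \<open>(W\<^sub>1, b\<^sub>1)\<close>, the list of the layers \<open>(W\<^sub>2, b\<^sub>2), \<dots>, (W\<^sub>H, b\<^sub>H)\<close>, and the output layer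
  \<open>(W\<^sub>H\<^sub>+\<^sub>1, b\<^sub>H\<^sub>+\<^sub>1)\<close>.\<close>

type_synonym ('i, 'o) layer = "(real ^ 'i ^ 'o) \<times> (real ^ 'o)"

type_synonym ('d1, 'w, 'd2) param =
  "('d1, 'w) layer \<times> ('w, 'w) layer list \<times> ('w, 'd2) layer"

definition affine_layer :: "('i::finite, 'o::finite) layer \<Rightarrow> real ^ 'i \<Rightarrow> real ^ 'o" where
  "affine_layer A x = fst A *v x + snd A"

definition tanh_layer :: "('i::finite, 'o::finite) layer \<Rightarrow> real ^ 'i \<Rightarrow> real ^ 'o" where
  "tanh_layer A x = (\<chi> i. tanh (affine_layer A x $ i))"

definition network ::
    "('d1::finite, 'w::finite, 'd2::finite) param \<Rightarrow> real ^ 'd1 \<Rightarrow> real ^ 'd2" where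
  "network \<theta> x = (case \<theta> of (A, As, B) \<Rightarrow> affine_layer B (fold tanh_layer As (tanh_layer A x)))"

definition param_space :: "nat \<Rightarrow> ('d1::finite, 'w::finite, 'd2::finite) param set" where
  "param_space H = {(A, As, B). length As = H - 1}"

text \<open>The norms on the right are Euclidean (Frobenius for matrices), so this is the Euclidean norm
  of the family of all weights and biases.\<close>

definition param_norm :: "('d1::finite, 'w::finite, 'd2::finite) param \<Rightarrow> real" where
  "param_norm \<theta> =
     (case \<theta> of (A, As, B) \<Rightarrow> sqrt ((norm A)\<^sup>2 + (\<Sum>A'\<leftarrow>As. (norm A')\<^sup>2) + (norm B)\<^sup>2))"

definition NN ::
    "'w::finite itself \<Rightarrow> nat \<Rightarrow> (real ^ 'd1::finite \<Rightarrow> real ^ 'd2::finite) set" where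
  "NN W H = network ` (param_space H :: ('d1, 'w, 'd2) param set)"

text \<open>In the risks, \<open>ld\<close> and \<open>le\<close> are the weights of the data and condition terms,
  \<open>X\<close>, \<open>Y\<close>, \<open>Xe\<close> and \<open>Xr\<close> are realizations of the samples, indexed from 0, and
  \<open>m\<close> is the number of operators.\<close>

definition empirical_risk ::
    "real \<Rightarrow> real \<Rightarrow> (real ^ 'd1::finite \<Rightarrow> real ^ 'd2::finite) \<Rightarrow>
     nat \<Rightarrow> (nat \<Rightarrow> (real ^ 'd1 \<Rightarrow> real ^ 'd2) \<Rightarrow> real ^ 'd1 \<Rightarrow> real) \<Rightarrow>
     nat \<Rightarrow> (nat \<Rightarrow> real ^ 'd1) \<Rightarrow> (nat \<Rightarrow> real ^ 'd2) \<Rightarrow>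
     nat \<Rightarrow> (nat \<Rightarrow> real ^ 'd1) \<Rightarrow> nat \<Rightarrow> (nat \<Rightarrow> real ^ 'd1) \<Rightarrow>
     (real ^ 'd1 \<Rightarrow> real ^ 'd2) \<Rightarrow> real" where
  "empirical_risk ld le h m \<F> n X Y ne Xe nr Xr u =
     ld / real n * (\<Sum>i<n. (norm (u (X i) - Y i))\<^sup>2)
     + le / real ne * (\<Sum>j<ne. (norm (u (Xe j) - h (Xe j)))\<^sup>2)
     + 1 / real nr * (\<Sum>k<m. \<Sum>l<nr. (\<F> k u (Xr l))\<^sup>2)"

definition theoretical_risk ::
    "(real ^ 'd1::finite) set \<Rightarrow> (real ^ 'd1) measure \<Rightarrow>
     real \<Rightarrow> real \<Rightarrow> (real ^ 'd1 \<Rightarrow> real ^ 'd2::finite) \<Rightarrow>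
     nat \<Rightarrow> (nat \<Rightarrow> (real ^ 'd1 \<Rightarrow> real ^ 'd2) \<Rightarrow> real ^ 'd1 \<Rightarrow> real) \<Rightarrow>
     nat \<Rightarrow> (nat \<Rightarrow> real ^ 'd1) \<Rightarrow> (nat \<Rightarrow> real ^ 'd2) \<Rightarrow>
     (real ^ 'd1 \<Rightarrow> real ^ 'd2) \<Rightarrow> real" where
  "theoretical_risk \<Omega> \<mu>E ld le h m \<F> n X Y u =
     ld / real n * (\<Sum>i<n. (norm (u (X i) - Y i))\<^sup>2)
     + le * (LINT x|\<mu>E. (norm (u x - h x))\<^sup>2)
     + 1 / measure lborel \<Omega> * (\<Sum>k<m. LINT x:\<Omega>|lborel. (\<F> k u x)\<^sup>2)"

definition minimizing_sequence :: "'t set \<Rightarrow> ('t \<Rightarrow> real) \<Rightarrow> (nat \<Rightarrow> 't) \<Rightarrow> bool" where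
  "minimizing_sequence T R \<theta> \<longleftrightarrow>
     (\<forall>p. \<theta> p \<in> T) \<and> (\<lambda>p. R (\<theta> p)) \<longlonglongrightarrow> (INF t\<in>T. R t)"

definition iid ::
    "'s measure \<Rightarrow> 'x measure \<Rightarrow> (nat \<Rightarrow> 's \<Rightarrow> 'x) \<Rightarrow> nat set \<Rightarrow> 'x measure \<Rightarrow> bool" where
  "iid P N Z I \<mu> \<longleftrightarrow>
     prob_space.indep_vars P (\<lambda>_. N) Z I \<and> (\<forall>i\<in>I. distr P N (Z i) = \<mu>)"

end

theory Submission
  imports Defs
begin

text \<open>Empirical and theoretical risk differ only in the means of the condition misfit and of the squared
residuals, which are averages over the samples in one and expectations in the other. The ridge
penalty confines the minimizing sequences: with \<open>N = min ne nr\<close> and penalty weight \<open>N\<close> to the power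
\<open>-\<kappa>\<close>, parameters with bounded penalized risk have norm of the order of \<open>N\<close> to the power \<open>\<kappa>/2\<close>, hence
at most \<open>N\<^sup>\<kappa>\<close> eventually. The theorem therefore follows, by comparing with a single nearly
optimal parameter whose penalty tends to 0 (\<open>ridge_minimizers_converge\<close>), once the averages are
shown to converge almost surely and uniformly over the growing balls of radius \<open>N\<^sup>\<kappa>\<close>.

Such a uniform law needs the integrands on the ball to be of smaller order than the square root of
the number of samples: Hoeffding's inequality then makes deviations exponentially unlikely in a power
of \<open>N\<close>, while a net of the ball has only polynomially many points because the integrands are Lipschitz
in the parameter with a constant that is polynomial in the radius. A union bound and the
Borel-Cantelli lemma conclude (\<open>uniform_law_via_finite_nets\<close>, \<open>uniform_law_for_tame\<close>).

The growth of the integrands is read off algebraically. As \<open>tanh' = 1 - tanh\<^sup>2\<close>, every derivative of a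
network is a polynomial in the outputs of its hidden units, which are bounded by 1, and in its weights;
each differentiation raises the degree in the weights by at most \<open>H\<close> (\<open>net_poly_deriv\<close>). Hence a
polynomial operator of degree \<open>d\<close> applied to a network is of order at most \<open>H d\<close> in the size of the
parameter (\<open>tame_polynomial_operator\<close>), and its square is of order \<open>2 H d\<close>. The value of \<open>\<kappa>\<close> makes
\<open>2 H d \<kappa>\<close> smaller than \<open>1/2\<close>.\<close>

section \<open>Networks, layer by layer\<close>

text \<open>The outputs of the individual hidden layers, as functions of the whole parameter. Layers beyond the
end of the list of a parameter are arbitrary, so that the equations hold for every parameter; this
lets derivatives in \<open>x\<close> be computed without reference to \<open>param_space\<close>.\<close>

primrec hidden ::
    "nat \<Rightarrow> ('d1::finite, 'w::finite, 'd2::finite) param \<Rightarrow> real ^ 'd1 \<Rightarrow> real ^ 'w" where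
  "hidden 0 \<theta> x = tanh_layer (fst \<theta>) x"
| "hidden (Suc l) \<theta> x = tanh_layer (fst (snd \<theta>) ! l) (hidden l \<theta> x)"

lemma fold_tanh_layer_take:
  "l \<le> length As \<Longrightarrow> fold tanh_layer (take l As) (tanh_layer A x) = hidden l (A, As, B) x"
  by (induction l) (auto simp: take_Suc_conv_app_nth)

text \<open>On parameters of depth \<open>H\<close> this is the network itself; unlike \<open>network\<close>, it is a polynomial in the
coordinates of \<open>hidden\<close> and of the output layer for all parameters.\<close>

definition network_total ::
    "nat \<Rightarrow> ('d1::finite, 'w::finite, 'd2::finite) param \<Rightarrow> real ^ 'd1 \<Rightarrow> real ^ 'd2" where
  "network_total H \<theta> x = affine_layer (snd (snd \<theta>)) (hidden (H - 1) \<theta> x)"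

lemma network_eq_network_total:
  assumes "\<theta> \<in> param_space H"
  shows "network \<theta> = network_total H \<theta>"
proof
  fix x
  obtain A As B where \<theta>: "\<theta> = (A, As, B)" by (cases \<theta>)
  with assms have "length As = H - 1" by (simp add: param_space_def)
  then show "network \<theta> x = network_total H \<theta> x"
    using fold_tanh_layer_take[of "H - 1" As A x B]
    by (simp add: network_def network_total_def \<theta>)
qed

section \<open>Size and distance of parameters\<close>

text \<open>Layers are controlled one at a time, in place of the Euclidean norm of the whole parameter: each layer
lives in a Euclidean space, so that nets and Lipschitz estimates reduce to single layers, while
the lists of layers carry no norm of their own.\<close>

definition bounded_param :: "real \<Rightarrow> ('d1::finite, 'w::finite, 'd2::finite) param \<Rightarrow> bool" where
  "bounded_param \<rho> \<theta> \<longleftrightarrow> (case \<theta> of (A, As, B) \<Rightarrow>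
     norm A \<le> \<rho> \<and> (\<forall>A' \<in> set As. norm A' \<le> \<rho>) \<and> norm B \<le> \<rho>)"

definition close_params ::
    "real \<Rightarrow> ('d1::finite, 'w::finite, 'd2::finite) param \<Rightarrow> ('d1, 'w, 'd2) param \<Rightarrow> bool" where
  "close_params \<delta> \<theta> \<theta>' \<longleftrightarrow> (case (\<theta>, \<theta>') of ((A, As, B), (A', As', B')) \<Rightarrow>
     norm (A - A') \<le> \<delta> \<and> list_all2 (\<lambda>a a'. norm (a - a') \<le> \<delta>) As As' \<and> norm (B - B') \<le> \<delta>)"

lemma close_params_nonneg: "close_params \<delta> \<theta> \<theta>' \<Longrightarrow> \<delta> \<ge> 0"
  by (auto simp: close_params_def split: prod.splits intro: order_trans[OF norm_ge_zero])

lemma bounded_param_mono: "bounded_param \<rho> \<theta> \<Longrightarrow> \<rho> \<le> \<rho>' \<Longrightarrow> bounded_param \<rho>' \<theta>"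
  by (fastforce simp: bounded_param_def split: prod.splits)

lemma bounded_param_of_close:
  assumes "bounded_param \<rho> \<theta>" and "close_params \<delta> \<theta> \<theta>'"
  shows "bounded_param (\<rho> + \<delta>) \<theta>'"
proof -
  have *: "norm b \<le> \<rho> + \<delta>" if "norm a \<le> \<rho>" "norm (a - b) \<le> \<delta>" for a b :: "'z::real_normed_vector"
    using that norm_triangle_ineq4[of a "a - b"] by simp
  show ?thesis
    using assms unfolding bounded_param_def close_params_def
    by (fastforce split: prod.splits intro: * simp: list_all2_conv_all_nth in_set_conv_nth)
qed

lemma bounded_param_of_param_norm:
  assumes "param_norm \<theta> \<le> \<rho>"
  shows "bounded_param \<rho> \<theta>"
proof -
  obtain A As B where \<theta>: "\<theta> = (A, As, B)" by (cases \<theta>)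
  let ?s = "(norm A)\<^sup>2 + (\<Sum>A'\<leftarrow>As. (norm A')\<^sup>2) + (norm B)\<^sup>2"
  have s0: "(\<Sum>A'\<leftarrow>As. (norm A')\<^sup>2) \<ge> 0" by (rule sum_list_nonneg) auto
  have m: "(norm A')\<^sup>2 \<le> (\<Sum>A'\<leftarrow>As. (norm A')\<^sup>2)" if "A' \<in> set As" for A'
    using that by (intro member_le_sum_list) auto
  have *: "norm C \<le> \<rho>" if "(norm C)\<^sup>2 \<le> ?s" for C :: "'z::real_normed_vector"
    using real_le_rsqrt[OF that] assms by (simp add: param_norm_def \<theta>)
  show ?thesis
    unfolding bounded_param_def \<theta> prod.case
  proof (intro conjI ballI)
    show "norm A \<le> \<rho>" using s0 by (intro *) simp
    show "norm B \<le> \<rho>" using s0 by (intro *) simp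
    show "norm A' \<le> \<rho>" if "A' \<in> set As" for A'
      using m[OF that] by (intro *) (smt (verit) zero_le_power2)
  qed
qed

text \<open>What the entries of the weight matrices and bias vectors have in common: as functions of the
parameter they are bounded by its size and Lipschitz with constant 1.\<close>

definition weight_coord ::
    "nat \<Rightarrow> (('d1::finite, 'w::finite, 'd2::finite) param \<Rightarrow> real) \<Rightarrow> bool" where
  "weight_coord H w \<longleftrightarrow>
     (\<forall>\<rho>. \<forall>\<theta>\<in>param_space H. bounded_param \<rho> \<theta> \<longrightarrow> \<bar>w \<theta>\<bar> \<le> \<rho>) \<and>
     (\<forall>\<delta>. \<forall>\<theta>\<in>param_space H. \<forall>\<theta>'\<in>param_space H. close_params \<delta> \<theta> \<theta>' \<longrightarrow> \<bar>w \<theta> - w \<theta>'\<bar> \<le> \<delta>)"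

lemma abs_weight_le_norm: "\<bar>fst L $ j $ k\<bar> \<le> norm (L :: ('i::finite, 'o::finite) layer)"
proof -
  have "\<bar>fst L $ j $ k\<bar> \<le> norm (fst L $ j)" by (rule component_le_norm_cart)
  also have "\<dots> \<le> norm (fst L)" by (rule Finite_Cartesian_Product.norm_nth_le)
  also have "\<dots> \<le> norm L" using norm_fst_le[of "fst L" "snd L"] by simp
  finally show ?thesis .
qed

lemma abs_bias_le_norm: "\<bar>snd L $ j\<bar> \<le> norm (L :: ('i::finite, 'o::finite) layer)"
proof -
  have "\<bar>snd L $ j\<bar> \<le> norm (snd L)" by (rule component_le_norm_cart)
  also have "\<dots> \<le> norm L" using norm_snd_le[of "snd L" "fst L"] by simp
  finally show ?thesis .
qed

lemma weight_coord_layer: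
  fixes L :: "('d1::finite, 'w::finite, 'd2::finite) param \<Rightarrow> ('i::finite, 'o::finite) layer"
  assumes "\<And>\<rho> \<theta>. \<theta> \<in> param_space H \<Longrightarrow> bounded_param \<rho> \<theta> \<Longrightarrow> norm (L \<theta>) \<le> \<rho>"
    and "\<And>\<delta> \<theta> \<theta>'. \<theta> \<in> param_space H \<Longrightarrow> \<theta>' \<in> param_space H \<Longrightarrow> close_params \<delta> \<theta> \<theta>' \<Longrightarrow>
      norm (L \<theta> - L \<theta>') \<le> \<delta>"
  shows "weight_coord H (\<lambda>\<theta>. fst (L \<theta>) $ j $ k)" and "weight_coord H (\<lambda>\<theta>. snd (L \<theta>) $ j)"
  unfolding weight_coord_def
proof (safe)
  fix \<rho> and \<theta> :: "('d1, 'w, 'd2) param"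
  assume "\<theta> \<in> param_space H" "bounded_param \<rho> \<theta>"
  then have "norm (L \<theta>) \<le> \<rho>" by (rule assms(1))
  then show "\<bar>fst (L \<theta>) $ j $ k\<bar> \<le> \<rho>" "\<bar>snd (L \<theta>) $ j\<bar> \<le> \<rho>"
    using abs_weight_le_norm[of "L \<theta>" j k] abs_bias_le_norm[of "L \<theta>" j] by linarith+
next
  fix \<delta> and \<theta> \<theta>' :: "('d1, 'w, 'd2) param"
  assume "\<theta> \<in> param_space H" "\<theta>' \<in> param_space H" "close_params \<delta> \<theta> \<theta>'"
  then have "norm (L \<theta> - L \<theta>') \<le> \<delta>" by (rule assms(2))
  then show "\<bar>fst (L \<theta>) $ j $ k - fst (L \<theta>') $ j $ k\<bar> \<le> \<delta>" "\<bar>snd (L \<theta>) $ j - snd (L \<theta>') $ j\<bar> \<le> \<delta>"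
    using abs_weight_le_norm[of "L \<theta> - L \<theta>'" j k] abs_bias_le_norm[of "L \<theta> - L \<theta>'" j] by simp_all
qed

lemma weight_coord_first:
  "weight_coord H (\<lambda>\<theta>. fst (fst \<theta>) $ j $ k)" "weight_coord H (\<lambda>\<theta>. snd (fst \<theta>) $ j)"
  by (rule weight_coord_layer; force simp: bounded_param_def close_params_def)+

lemma weight_coord_last:
  "weight_coord H (\<lambda>\<theta>. fst (snd (snd \<theta>)) $ j $ k)" "weight_coord H (\<lambda>\<theta>. snd (snd (snd \<theta>)) $ j)"
  by (rule weight_coord_layer; force simp: bounded_param_def close_params_def)+

lemma weight_coord_hidden:
  assumes "l < H - 1"
  shows "weight_coord H (\<lambda>\<theta>. fst (fst (snd \<theta>) ! l) $ j $ k)"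
    "weight_coord H (\<lambda>\<theta>. snd (fst (snd \<theta>) ! l) $ j)"
  by (rule weight_coord_layer;
      use assms in \<open>auto simp: bounded_param_def close_params_def param_space_def list_all2_conv_all_nth\<close>)+

section \<open>Tame functions: polynomial growth and Lipschitz bounds in the parameter\<close>

text \<open>The two quantitative properties that the uniform law of large numbers consumes. The exponent \<open>m\<close> of the
growth decides whether averages concentrate uniformly on a ball whose radius grows with the
sample size, so it is tracked; the Lipschitz exponent \<open>b\<close> only influences the size of a net, which
enters the argument through its logarithm, and is existentially quantified. All bounds are uniform
over \<open>x \<in> S\<close>.\<close>

definition tame ::
    "nat \<Rightarrow> (real ^ 'd1::finite) set \<Rightarrow> nat \<Rightarrow>
     (('d1, 'w::finite, 'd2::finite) param \<Rightarrow> real ^ 'd1 \<Rightarrow> real) \<Rightarrow> bool" where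
  "tame H S m g \<longleftrightarrow>
     (\<forall>\<theta>\<in>param_space H. continuous_on S (g \<theta>)) \<and>
     (\<exists>C\<ge>0. \<exists>b. \<forall>\<rho>\<ge>1. \<forall>\<theta>\<in>param_space H. bounded_param \<rho> \<theta> \<longrightarrow> (\<forall>x\<in>S.
        \<bar>g \<theta> x\<bar> \<le> C * \<rho> ^ m \<and>
        (\<forall>\<theta>'\<in>param_space H. bounded_param \<rho> \<theta>' \<longrightarrow> (\<forall>\<delta>. close_params \<delta> \<theta> \<theta>' \<longrightarrow>
           \<bar>g \<theta> x - g \<theta>' x\<bar> \<le> C * \<rho> ^ b * \<delta>))))"

lemma tameI:
  fixes g :: "('d1::finite, 'w::finite, 'd2::finite) param \<Rightarrow> real ^ 'd1 \<Rightarrow> real"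
  assumes "\<And>\<theta>. \<theta> \<in> param_space H \<Longrightarrow> continuous_on S (g \<theta>)" and "C \<ge> 0"
    and "\<And>\<rho> \<theta> x. \<rho> \<ge> 1 \<Longrightarrow> \<theta> \<in> param_space H \<Longrightarrow> bounded_param \<rho> \<theta> \<Longrightarrow> x \<in> S \<Longrightarrow> \<bar>g \<theta> x\<bar> \<le> C * \<rho> ^ m"
    and "\<And>\<rho> \<theta> \<theta>' \<delta> x. \<rho> \<ge> 1 \<Longrightarrow> \<theta> \<in> param_space H \<Longrightarrow> bounded_param \<rho> \<theta> \<Longrightarrow>
       \<theta>' \<in> param_space H \<Longrightarrow> bounded_param \<rho> \<theta>' \<Longrightarrow> close_params \<delta> \<theta> \<theta>' \<Longrightarrow> x \<in> S \<Longrightarrow>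
       \<bar>g \<theta> x - g \<theta>' x\<bar> \<le> C * \<rho> ^ b * \<delta>"
  shows "tame H S m g"
  unfolding tame_def using assms by blast

lemma tameE:
  fixes g :: "('d1::finite, 'w::finite, 'd2::finite) param \<Rightarrow> real ^ 'd1 \<Rightarrow> real"
  assumes "tame H S m g"
  obtains C b where "\<And>\<theta>. \<theta> \<in> param_space H \<Longrightarrow> continuous_on S (g \<theta>)" and "C \<ge> 0"
    and "\<And>\<rho> \<theta> x. \<rho> \<ge> 1 \<Longrightarrow> \<theta> \<in> param_space H \<Longrightarrow> bounded_param \<rho> \<theta> \<Longrightarrow> x \<in> S \<Longrightarrow> \<bar>g \<theta> x\<bar> \<le> C * \<rho> ^ m"
    and "\<And>\<rho> \<theta> \<theta>' \<delta> x. \<rho> \<ge> 1 \<Longrightarrow> \<theta> \<in> param_space H \<Longrightarrow> bounded_param \<rho> \<theta> \<Longrightarrow>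
       \<theta>' \<in> param_space H \<Longrightarrow> bounded_param \<rho> \<theta>' \<Longrightarrow> close_params \<delta> \<theta> \<theta>' \<Longrightarrow> x \<in> S \<Longrightarrow>
       \<bar>g \<theta> x - g \<theta>' x\<bar> \<le> C * \<rho> ^ b * \<delta>"
proof -
  obtain C b where "C \<ge> 0" and *: "\<forall>\<rho>\<ge>1. \<forall>\<theta>\<in>param_space H. bounded_param \<rho> \<theta> \<longrightarrow> (\<forall>x\<in>S.
        \<bar>g \<theta> x\<bar> \<le> C * \<rho> ^ m \<and>
        (\<forall>\<theta>'\<in>param_space H. bounded_param \<rho> \<theta>' \<longrightarrow> (\<forall>\<delta>. close_params \<delta> \<theta> \<theta>' \<longrightarrow>
           \<bar>g \<theta> x - g \<theta>' x\<bar> \<le> C * \<rho> ^ b * \<delta>)))"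
    using assms unfolding tame_def by blast
  show thesis
    by (rule that[of C b]) (use assms \<open>C \<ge> 0\<close> * in \<open>auto simp: tame_def\<close>)
qed

lemma tame_mono:
  fixes g :: "('d1::finite, 'w::finite, 'd2::finite) param \<Rightarrow> real ^ 'd1 \<Rightarrow> real"
  assumes "tame H S m g" and "m \<le> m'"
  shows "tame H S m' g"
proof -
  from assms(1) obtain C b where g: "\<And>\<theta>. \<theta> \<in> param_space H \<Longrightarrow> continuous_on S (g \<theta>)" "C \<ge> 0"
    "\<And>\<rho> \<theta> x. \<rho> \<ge> 1 \<Longrightarrow> \<theta> \<in> param_space H \<Longrightarrow> bounded_param \<rho> \<theta> \<Longrightarrow> x \<in> S \<Longrightarrow> \<bar>g \<theta> x\<bar> \<le> C * \<rho> ^ m"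
    "\<And>\<rho> \<theta> \<theta>' \<delta> x. \<rho> \<ge> 1 \<Longrightarrow> \<theta> \<in> param_space H \<Longrightarrow> bounded_param \<rho> \<theta> \<Longrightarrow>
       \<theta>' \<in> param_space H \<Longrightarrow> bounded_param \<rho> \<theta>' \<Longrightarrow> close_params \<delta> \<theta> \<theta>' \<Longrightarrow> x \<in> S \<Longrightarrow>
       \<bar>g \<theta> x - g \<theta>' x\<bar> \<le> C * \<rho> ^ b * \<delta>"
    by (rule tameE) blast
  have pow: "C * \<rho> ^ m \<le> C * \<rho> ^ m'" if "\<rho> \<ge> 1" for \<rho> :: real
    using that g(2) assms(2) by (intro mult_left_mono power_increasing)
  show ?thesis
  proof (rule tameI[where C = C and b = b])
    show "\<bar>g \<theta> x\<bar> \<le> C * \<rho> ^ m'"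
      if "\<rho> \<ge> 1" "\<theta> \<in> param_space H" "bounded_param \<rho> \<theta>" "x \<in> S" for \<rho> \<theta> x
      using g(3)[OF that] pow[OF that(1)] by linarith
  qed (rule g; assumption)+
qed

lemma tame_const:
  fixes c :: "real ^ 'd1::finite \<Rightarrow> real"
  assumes "continuous_on S c" and "\<And>x. x \<in> S \<Longrightarrow> \<bar>c x\<bar> \<le> C"
  shows "tame H S 0 (\<lambda>\<theta> :: ('d1, 'w::finite, 'd2::finite) param. c)"
proof (rule tameI[where C = "\<bar>C\<bar>" and b = 0])
  show "\<bar>c x\<bar> \<le> \<bar>C\<bar> * \<rho> ^ 0" if "x \<in> S" for x and \<rho> :: real
    using assms(2)[OF that] by auto
  show "\<bar>c x - c x\<bar> \<le> \<bar>C\<bar> * \<rho> ^ 0 * \<delta>"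
    if "close_params \<delta> \<theta> \<theta>'" for x \<rho> \<delta> and \<theta> \<theta>' :: "('d1, 'w, 'd2) param"
    using close_params_nonneg[OF that] by simp
qed (use assms in auto)

lemma tame_weight:
  assumes "weight_coord H w"
  shows "tame H S 1 (\<lambda>\<theta> x. w \<theta>)"
  by (rule tameI[where C = 1 and b = 0]) (use assms in \<open>auto simp: weight_coord_def\<close>)

lemma tame_add:
  fixes g k :: "('d1::finite, 'w::finite, 'd2::finite) param \<Rightarrow> real ^ 'd1 \<Rightarrow> real"
  assumes "tame H S m g" and "tame H S m k"
  shows "tame H S m (\<lambda>\<theta> x. g \<theta> x + k \<theta> x)"
proof -
  from assms(1) obtain C b where g: "\<And>\<theta>. \<theta> \<in> param_space H \<Longrightarrow> continuous_on S (g \<theta>)" "C \<ge> 0"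
    "\<And>\<rho> \<theta> x. \<rho> \<ge> 1 \<Longrightarrow> \<theta> \<in> param_space H \<Longrightarrow> bounded_param \<rho> \<theta> \<Longrightarrow> x \<in> S \<Longrightarrow> \<bar>g \<theta> x\<bar> \<le> C * \<rho> ^ m"
    "\<And>\<rho> \<theta> \<theta>' \<delta> x. \<rho> \<ge> 1 \<Longrightarrow> \<theta> \<in> param_space H \<Longrightarrow> bounded_param \<rho> \<theta> \<Longrightarrow>
       \<theta>' \<in> param_space H \<Longrightarrow> bounded_param \<rho> \<theta>' \<Longrightarrow> close_params \<delta> \<theta> \<theta>' \<Longrightarrow> x \<in> S \<Longrightarrow>
       \<bar>g \<theta> x - g \<theta>' x\<bar> \<le> C * \<rho> ^ b * \<delta>"
    by (rule tameE) blast
  from assms(2) obtain C' b' where k: "\<And>\<theta>. \<theta> \<in> param_space H \<Longrightarrow> continuous_on S (k \<theta>)" "C' \<ge> 0"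
    "\<And>\<rho> \<theta> x. \<rho> \<ge> 1 \<Longrightarrow> \<theta> \<in> param_space H \<Longrightarrow> bounded_param \<rho> \<theta> \<Longrightarrow> x \<in> S \<Longrightarrow> \<bar>k \<theta> x\<bar> \<le> C' * \<rho> ^ m"
    "\<And>\<rho> \<theta> \<theta>' \<delta> x. \<rho> \<ge> 1 \<Longrightarrow> \<theta> \<in> param_space H \<Longrightarrow> bounded_param \<rho> \<theta> \<Longrightarrow>
       \<theta>' \<in> param_space H \<Longrightarrow> bounded_param \<rho> \<theta>' \<Longrightarrow> close_params \<delta> \<theta> \<theta>' \<Longrightarrow> x \<in> S \<Longrightarrow>
       \<bar>k \<theta> x - k \<theta>' x\<bar> \<le> C' * \<rho> ^ b' * \<delta>"
    by (rule tameE) blast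
  show ?thesis
  proof (rule tameI[where C = "C + C'" and b = "b + b'"])
    fix \<rho> :: real and \<theta> \<theta>' :: "('d1, 'w, 'd2) param" and \<delta> x
    assume r: "\<rho> \<ge> 1" "\<theta> \<in> param_space H" "bounded_param \<rho> \<theta>" and x: "x \<in> S"
    show "\<bar>g \<theta> x + k \<theta> x\<bar> \<le> (C + C') * \<rho> ^ m"
      using g(3)[OF r x] k(3)[OF r x] by (simp add: algebra_simps)
    assume t: "\<theta>' \<in> param_space H" "bounded_param \<rho> \<theta>'" "close_params \<delta> \<theta> \<theta>'"
    have \<delta>: "\<delta> \<ge> 0" using t(3) by (rule close_params_nonneg)
    have "C * \<rho> ^ b * \<delta> \<le> C * \<rho> ^ (b + b') * \<delta>"
      using r g(2) \<delta> by (intro mult_right_mono mult_left_mono power_increasing) auto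
    moreover have "C' * \<rho> ^ b' * \<delta> \<le> C' * \<rho> ^ (b + b') * \<delta>"
      using r k(2) \<delta> by (intro mult_right_mono mult_left_mono power_increasing) auto
    ultimately show "\<bar>g \<theta> x + k \<theta> x - (g \<theta>' x + k \<theta>' x)\<bar> \<le> (C + C') * \<rho> ^ (b + b') * \<delta>"
      using g(4)[OF r t x] k(4)[OF r t x] by (simp add: algebra_simps)
  qed (use g k in \<open>auto intro: continuous_intros\<close>)
qed

lemma tame_mult:
  fixes g k :: "('d1::finite, 'w::finite, 'd2::finite) param \<Rightarrow> real ^ 'd1 \<Rightarrow> real"
  assumes "tame H S m g" and "tame H S m' k"
  shows "tame H S (m + m') (\<lambda>\<theta> x. g \<theta> x * k \<theta> x)"
proof -
  from assms(1) obtain C b where g: "\<And>\<theta>. \<theta> \<in> param_space H \<Longrightarrow> continuous_on S (g \<theta>)" "C \<ge> 0"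
    "\<And>\<rho> \<theta> x. \<rho> \<ge> 1 \<Longrightarrow> \<theta> \<in> param_space H \<Longrightarrow> bounded_param \<rho> \<theta> \<Longrightarrow> x \<in> S \<Longrightarrow> \<bar>g \<theta> x\<bar> \<le> C * \<rho> ^ m"
    "\<And>\<rho> \<theta> \<theta>' \<delta> x. \<rho> \<ge> 1 \<Longrightarrow> \<theta> \<in> param_space H \<Longrightarrow> bounded_param \<rho> \<theta> \<Longrightarrow>
       \<theta>' \<in> param_space H \<Longrightarrow> bounded_param \<rho> \<theta>' \<Longrightarrow> close_params \<delta> \<theta> \<theta>' \<Longrightarrow> x \<in> S \<Longrightarrow>
       \<bar>g \<theta> x - g \<theta>' x\<bar> \<le> C * \<rho> ^ b * \<delta>"
    by (rule tameE) blast
  from assms(2) obtain C' b' where k: "\<And>\<theta>. \<theta> \<in> param_space H \<Longrightarrow> continuous_on S (k \<theta>)" "C' \<ge> 0"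
    "\<And>\<rho> \<theta> x. \<rho> \<ge> 1 \<Longrightarrow> \<theta> \<in> param_space H \<Longrightarrow> bounded_param \<rho> \<theta> \<Longrightarrow> x \<in> S \<Longrightarrow> \<bar>k \<theta> x\<bar> \<le> C' * \<rho> ^ m'"
    "\<And>\<rho> \<theta> \<theta>' \<delta> x. \<rho> \<ge> 1 \<Longrightarrow> \<theta> \<in> param_space H \<Longrightarrow> bounded_param \<rho> \<theta> \<Longrightarrow>
       \<theta>' \<in> param_space H \<Longrightarrow> bounded_param \<rho> \<theta>' \<Longrightarrow> close_params \<delta> \<theta> \<theta>' \<Longrightarrow> x \<in> S \<Longrightarrow>
       \<bar>k \<theta> x - k \<theta>' x\<bar> \<le> C' * \<rho> ^ b' * \<delta>"
    by (rule tameE) blast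
  show ?thesis
  proof (rule tameI[where C = "2 * (C * C')" and b = "m + m' + b + b'"])
    fix \<rho> :: real and \<theta> \<theta>' :: "('d1, 'w, 'd2) param" and \<delta> x
    assume r: "\<rho> \<ge> 1" "\<theta> \<in> param_space H" "bounded_param \<rho> \<theta>" and x: "x \<in> S"
    have "\<bar>g \<theta> x * k \<theta> x\<bar> \<le> (C * \<rho> ^ m) * (C' * \<rho> ^ m')"
      unfolding abs_mult using g(3)[OF r x] k(3)[OF r x] by (intro mult_mono) auto
    also have "\<dots> \<le> 2 * (C * C') * \<rho> ^ (m + m')"
      using r(1) g(2) k(2) by (simp add: power_add algebra_simps)
    finally show "\<bar>g \<theta> x * k \<theta> x\<bar> \<le> 2 * (C * C') * \<rho> ^ (m + m')" .
    assume t: "\<theta>' \<in> param_space H" "bounded_param \<rho> \<theta>'" "close_params \<delta> \<theta> \<theta>'"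
    have \<delta>: "\<delta> \<ge> 0" using t(3) by (rule close_params_nonneg)
    have p1: "\<rho> ^ (m + b') \<le> \<rho> ^ (m + m' + b + b')" and p2: "\<rho> ^ (b + m') \<le> \<rho> ^ (m + m' + b + b')"
      using r(1) by (auto intro: power_increasing)
    have "\<bar>g \<theta> x * k \<theta> x - g \<theta>' x * k \<theta>' x\<bar>
        = \<bar>g \<theta> x * (k \<theta> x - k \<theta>' x) + (g \<theta> x - g \<theta>' x) * k \<theta>' x\<bar>"
      by (simp add: algebra_simps)
    also have "\<dots> \<le> \<bar>g \<theta> x\<bar> * \<bar>k \<theta> x - k \<theta>' x\<bar> + \<bar>g \<theta> x - g \<theta>' x\<bar> * \<bar>k \<theta>' x\<bar>"
      using abs_triangle_ineq by (metis abs_mult)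
    also have "\<dots> \<le> (C * \<rho> ^ m) * (C' * \<rho> ^ b' * \<delta>) + (C * \<rho> ^ b * \<delta>) * (C' * \<rho> ^ m')"
      using g(3)[OF r x] k(4)[OF r t x] g(4)[OF r t x] k(3)[OF r(1) t(1,2) x]
      by (intro add_mono mult_mono) auto
    also have "\<dots> = (C * C') * (\<rho> ^ (m + b') + \<rho> ^ (b + m')) * \<delta>"
      by (simp add: power_add algebra_simps)
    also have "\<dots> \<le> (C * C') * (\<rho> ^ (m + m' + b + b') + \<rho> ^ (m + m' + b + b')) * \<delta>"
      using r(1) g(2) k(2) \<delta> p1 p2 by (intro mult_right_mono mult_left_mono add_mono[OF p1 p2]) auto
    finally show "\<bar>g \<theta> x * k \<theta> x - g \<theta>' x * k \<theta>' x\<bar> \<le> 2 * (C * C') * \<rho> ^ (m + m' + b + b') * \<delta>"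
      by (simp add: algebra_simps)
  qed (use g k in \<open>auto intro: continuous_intros\<close>)
qed

lemma tanh_diff_le: "\<bar>tanh a - tanh b\<bar> \<le> \<bar>a - b\<bar>" for a b :: real
proof -
  have "norm (tanh a - tanh b) \<le> 1 * norm (a - b)"
  proof (rule field_differentiable_bound[of UNIV tanh "\<lambda>x. 1 - tanh x ^ 2"])
    show "(tanh has_field_derivative 1 - (tanh z)\<^sup>2) (at z within UNIV)" for z :: real
      by (rule has_field_derivative_tanh[THEN DERIV_cong, THEN has_field_derivative_at_within])
         (auto intro: derivative_eq_intros)
    show "norm (1 - (tanh z)\<^sup>2) \<le> 1" for z :: real
      using tanh_real_bounds[of z] abs_square_le_1[of "tanh z"] by auto
  qed auto
  then show ?thesis by simp
qed

text \<open>Since \<open>tanh\<close> is bounded, it resets the growth exponent to 0, whatever the growth of its argument. This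
is why growth is governed by the number of weights that appear outside of activations.\<close>

lemma tame_tanh:
  fixes g :: "('d1::finite, 'w::finite, 'd2::finite) param \<Rightarrow> real ^ 'd1 \<Rightarrow> real"
  assumes "tame H S m g"
  shows "tame H S 0 (\<lambda>\<theta> x. tanh (g \<theta> x))"
proof -
  from assms(1) obtain C b where g: "\<And>\<theta>. \<theta> \<in> param_space H \<Longrightarrow> continuous_on S (g \<theta>)" "C \<ge> 0"
    "\<And>\<rho> \<theta> \<theta>' \<delta> x. \<rho> \<ge> 1 \<Longrightarrow> \<theta> \<in> param_space H \<Longrightarrow> bounded_param \<rho> \<theta> \<Longrightarrow>
       \<theta>' \<in> param_space H \<Longrightarrow> bounded_param \<rho> \<theta>' \<Longrightarrow> close_params \<delta> \<theta> \<theta>' \<Longrightarrow> x \<in> S \<Longrightarrow>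
       \<bar>g \<theta> x - g \<theta>' x\<bar> \<le> C * \<rho> ^ b * \<delta>"
    by (rule tameE) blast
  show ?thesis
  proof (rule tameI[where C = "C + 1" and b = b])
    fix \<rho> :: real and \<theta> \<theta>' :: "('d1, 'w, 'd2) param" and \<delta> x
    assume r: "\<rho> \<ge> 1" "\<theta> \<in> param_space H" "bounded_param \<rho> \<theta>" and x: "x \<in> S"
    show "\<bar>tanh (g \<theta> x)\<bar> \<le> (C + 1) * \<rho> ^ 0"
      using tanh_real_bounds[of "g \<theta> x"] g(2) by auto
    assume t: "\<theta>' \<in> param_space H" "bounded_param \<rho> \<theta>'" "close_params \<delta> \<theta> \<theta>'"
    have \<delta>: "\<rho> ^ b * \<delta> \<ge> 0" using close_params_nonneg[OF t(3)] r by auto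
    show "\<bar>tanh (g \<theta> x) - tanh (g \<theta>' x)\<bar> \<le> (C + 1) * \<rho> ^ b * \<delta>"
      using tanh_diff_le[of "g \<theta> x" "g \<theta>' x"] g(3)[OF r t x] \<delta> by (simp add: algebra_simps)
  qed (use g in \<open>auto intro!: continuous_intros\<close>)
qed

lemma tame_sum:
  assumes "\<And>i. i \<in> I \<Longrightarrow> tame H S m (g i)"
  shows "tame H S m (\<lambda>\<theta> x. \<Sum>i\<in>I. g i \<theta> x)"
proof -
  have z: "tame H S m (\<lambda>\<theta> x. 0)"
    by (rule tame_mono[OF tame_const[where C = 0]]) auto
  show ?thesis
    using assms by (induction I rule: infinite_finite_induct) (auto intro: tame_add z)
qed

lemma tame_prod:
  assumes "finite I" and "\<And>i. i \<in> I \<Longrightarrow> tame H S (d i) (g i)"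
  shows "tame H S (\<Sum>i\<in>I. d i) (\<lambda>\<theta> x. \<Prod>i\<in>I. g i \<theta> x)"
  using assms
proof (induction I rule: finite_induct)
  case empty
  then show ?case by (auto intro: tame_const[where C = 1])
next
  case (insert a I)
  then show ?case by (simp add: tame_mult)
qed

lemma tame_power:
  assumes "tame H S m g"
  shows "tame H S (m * k) (\<lambda>\<theta> x. g \<theta> x ^ k)"
  using tame_prod[of "{..<k}" H S "\<lambda>_. m" "\<lambda>_. g"] assms by (simp add: mult.commute)

lemma hidden_nth:
  "hidden 0 \<theta> x $ j = tanh ((\<Sum>k\<in>UNIV. fst (fst \<theta>) $ j $ k * x $ k) + snd (fst \<theta>) $ j)"
  "hidden (Suc l) \<theta> x $ j =
     tanh ((\<Sum>k\<in>UNIV. fst (fst (snd \<theta>) ! l) $ j $ k * hidden l \<theta> x $ k) + snd (fst (snd \<theta>) ! l) $ j)"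
  by (simp_all add: tanh_layer_def affine_layer_def matrix_vector_mult_def)

lemma network_total_nth:
  "network_total H \<theta> x $ j =
     (\<Sum>k\<in>UNIV. fst (snd (snd \<theta>)) $ j $ k * hidden (H - 1) \<theta> x $ k) + snd (snd (snd \<theta>)) $ j"
  by (simp add: network_total_def affine_layer_def matrix_vector_mult_def)

text \<open>Boundedness of \<open>S\<close> is needed for the first layer, whose dependence on the weights is scaled by the
input.\<close>

lemma tame_hidden:
  fixes S :: "(real ^ 'd1::finite) set"
  assumes "bounded S" and "l < H"
  shows "tame H S 0 (\<lambda>(\<theta> :: ('d1, 'w::finite, 'd2::finite) param) x. hidden l \<theta> x $ j)"
  using assms(2)
proof (induction l arbitrary: j)
  case 0
  obtain B where B: "\<And>x. x \<in> S \<Longrightarrow> norm x \<le> B" using assms(1) by (auto simp: bounded_iff)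
  have c: "tame H S 0 (\<lambda>(\<theta> :: ('d1, 'w, 'd2) param) x. x $ k)" for k
  proof (rule tame_const[where C = B])
    show "\<bar>x $ k\<bar> \<le> B" if "x \<in> S" for x
      using B[OF that] component_le_norm_cart[of x k] by linarith
  qed (intro continuous_intros)
  have "tame H S 1 (\<lambda>(\<theta> :: ('d1, 'w, 'd2) param) x. fst (fst \<theta>) $ j $ k * x $ k)" for k
    using tame_mult[OF tame_weight[OF weight_coord_first(1)] c] by simp
  then show ?case unfolding hidden_nth
    by (intro tame_tanh[where m = 1] tame_add tame_sum tame_weight weight_coord_first)
next
  case (Suc l)
  then have l: "l < H - 1" "l < H" by auto
  have "tame H S 1 (\<lambda>(\<theta> :: ('d1, 'w, 'd2) param) x.
      fst (fst (snd \<theta>) ! l) $ j $ k * hidden l \<theta> x $ k)" for k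
    using tame_mult[OF tame_weight[OF weight_coord_hidden(1)[OF l(1)]] Suc.IH[OF l(2)]] by simp
  then show ?case unfolding hidden_nth
    by (intro tame_tanh[where m = 1] tame_add tame_sum tame_weight weight_coord_hidden l)
qed

section \<open>Derivatives of networks\<close>

text \<open>Polynomials in the outputs of the hidden units and in the weights, of degree at most \<open>m\<close> in the
weights. Because \<open>tanh' = 1 - tanh\<^sup>2\<close>, this class is closed under partial derivatives in \<open>x\<close>, so it
contains all derivatives of all orders of a network, while hidden units being bounded makes \<open>m\<close> a
growth exponent.\<close>

inductive net_poly ::
    "nat \<Rightarrow> nat \<Rightarrow> (('d1::finite, 'w::finite, 'd2::finite) param \<Rightarrow> real ^ 'd1 \<Rightarrow> real) \<Rightarrow> bool"
  for H where
  const: "net_poly H m (\<lambda>\<theta> x. c)"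
| unit: "l < H \<Longrightarrow> net_poly H m (\<lambda>\<theta> x. hidden l \<theta> x $ j)"
| weight: "weight_coord H w \<Longrightarrow> net_poly H (Suc m) (\<lambda>\<theta> x. w \<theta>)"
| add: "net_poly H m g \<Longrightarrow> net_poly H m k \<Longrightarrow> net_poly H m (\<lambda>\<theta> x. g \<theta> x + k \<theta> x)"
| mult: "net_poly H m g \<Longrightarrow> net_poly H m' k \<Longrightarrow> net_poly H (m + m') (\<lambda>\<theta> x. g \<theta> x * k \<theta> x)"

lemma net_poly_raise: "net_poly H m g \<Longrightarrow> m \<le> m' \<Longrightarrow> net_poly H m' g"
proof (induction arbitrary: m' rule: net_poly.induct)
  case (weight w m)
  then show ?case by (metis Suc_le_D net_poly.weight)
next
  case (mult m g n k)
  then show ?case using net_poly.mult[of H m g "m' - m" k] by simp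
qed (auto intro: net_poly.intros)

lemma net_poly_sum:
  "(\<And>i. i \<in> I \<Longrightarrow> net_poly H m (g i)) \<Longrightarrow> net_poly H m (\<lambda>\<theta> x. \<Sum>i\<in>I. g i \<theta> x)"
  by (induction I rule: infinite_finite_induct) (auto intro: net_poly.const net_poly.add)

lemma tame_net_poly:
  assumes "bounded S" and "net_poly H m g"
  shows "tame H S m g"
  using assms(2)
proof (induction rule: net_poly.induct)
  case (const m c)
  then show ?case by (rule tame_mono[OF tame_const[where C = "\<bar>c\<bar>"]]) auto
next
  case (unit l m j)
  then show ?case using tame_mono[OF tame_hidden[OF assms(1)]] by blast
next
  case (weight w m)
  then show ?case using tame_mono[OF tame_weight] by fastforce
qed (auto intro: tame_add tame_mult)

text \<open>The exponent is 1 because only the weights of the output layer appear outside of the activations.\<close>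

lemma net_poly_network:
  assumes "H \<ge> 1"
  shows "net_poly H 1 (\<lambda>\<theta> x. network_total H \<theta> x $ j)"
  unfolding network_total_nth
proof (intro net_poly.add net_poly_sum)
  show "net_poly H 1 (\<lambda>\<theta> x. fst (snd (snd \<theta>)) $ j $ k * hidden (H - 1) \<theta> x $ k)" for k
    using net_poly.mult[OF net_poly.weight[OF weight_coord_last(1), of H 0 j k] net_poly.unit[of "H - 1" H 0 k]]
      assms by simp
  show "net_poly H 1 (\<lambda>\<theta> x. snd (snd (snd \<theta>)) $ j)"
    using net_poly.weight[OF weight_coord_last(2), of H 0] by simp
qed

text \<open>The derivative function is an argument and a function of both the parameter and \<open>x\<close>, so that \<open>net_poly\<close>
applies to it.\<close>

definition has_axis_deriv ::
    "'d1::finite \<Rightarrow> (('d1, 'w::finite, 'd2::finite) param \<Rightarrow> real ^ 'd1 \<Rightarrow> real) \<Rightarrow>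
     (('d1, 'w, 'd2) param \<Rightarrow> real ^ 'd1 \<Rightarrow> real) \<Rightarrow> bool" where
  "has_axis_deriv i g g' \<longleftrightarrow>
     (\<forall>\<theta> x. ((\<lambda>t. g \<theta> (x + t *\<^sub>R axis i 1)) has_real_derivative g' \<theta> x) (at 0))"

lemma has_axis_deriv_add:
  assumes "has_axis_deriv i g g'" and "has_axis_deriv i k k'"
  shows "has_axis_deriv i (\<lambda>\<theta> x. g \<theta> x + k \<theta> x) (\<lambda>\<theta> x. g' \<theta> x + k' \<theta> x)"
  unfolding has_axis_deriv_def
  by (intro allI DERIV_add assms[unfolded has_axis_deriv_def, rule_format])

lemma has_axis_deriv_mult:
  assumes "has_axis_deriv i g g'" and "has_axis_deriv i k k'"
  shows "has_axis_deriv i (\<lambda>\<theta> x. g \<theta> x * k \<theta> x) (\<lambda>\<theta> x. g' \<theta> x * k \<theta> x + g \<theta> x * k' \<theta> x)"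
  unfolding has_axis_deriv_def
proof (intro allI)
  fix \<theta> x
  show "((\<lambda>t. g \<theta> (x + t *\<^sub>R axis i 1) * k \<theta> (x + t *\<^sub>R axis i 1)) has_real_derivative
      g' \<theta> x * k \<theta> x + g \<theta> x * k' \<theta> x) (at 0)"
    using DERIV_mult[OF assms[unfolded has_axis_deriv_def, rule_format], of \<theta> x \<theta> x]
    by (simp add: mult.commute)
qed

text \<open>By the chain rule, differentiating a unit of layer \<open>l\<close> produces one weight factor from each layer that
the derivative passes through, from layer \<open>l\<close> down to the input. Counting from 0, these are \<open>l + 1\<close>
factors.\<close>

lemma hidden_deriv:
  fixes i :: "'d1::finite" and j :: "'w::finite"
  assumes "l < H"
  shows "\<exists>g'. net_poly H (Suc l) g' \<and>
    has_axis_deriv i (\<lambda>(\<theta> :: ('d1, 'w, 'd2::finite) param) x. hidden l \<theta> x $ j) g'"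
  using assms
proof (induction l arbitrary: j)
  case 0
  let ?g = "\<lambda>(\<theta> :: ('d1, 'w, 'd2) param) x.
     (1 + (-1) * (hidden 0 \<theta> x $ j * hidden 0 \<theta> x $ j)) * fst (fst \<theta>) $ j $ i"
  have "net_poly H (0 + Suc 0) ?g"
    using 0 by (intro net_poly.mult[where m = 0] net_poly.add net_poly.const net_poly.weight weight_coord_first
        net_poly.mult[where m = 0 and m' = 0, simplified] net_poly.unit)
  moreover have "has_axis_deriv i (\<lambda>(\<theta> :: ('d1, 'w, 'd2) param) x. hidden 0 \<theta> x $ j) ?g"
  proof -
    have "(\<Sum>k\<in>UNIV. a k * axis i 1 $ k) = a i" "(\<Sum>k\<in>UNIV. axis i 1 $ k * a k) = a i"
      for a :: "'d1 \<Rightarrow> real"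
      by (subst sum.remove[of _ i]; auto simp: axis_def)+
    then show ?thesis
      unfolding has_axis_deriv_def hidden_nth
      by (auto intro!: derivative_eq_intros simp: power2_eq_square)
  qed
  ultimately show ?case by auto
next
  case (Suc l)
  then obtain g where g: "\<And>k. net_poly H (Suc l) (g k)"
    and d: "\<And>k. has_axis_deriv i (\<lambda>(\<theta> :: ('d1, 'w, 'd2) param) x. hidden l \<theta> x $ k) (g k)"
    by (metis Suc_lessD)
  let ?g = "\<lambda>(\<theta> :: ('d1, 'w, 'd2) param) x.
     (1 + (-1) * (hidden (Suc l) \<theta> x $ j * hidden (Suc l) \<theta> x $ j)) *
       (\<Sum>k\<in>UNIV. fst (fst (snd \<theta>) ! l) $ j $ k * g k \<theta> x)"
  have "net_poly H (0 + (Suc 0 + Suc l)) ?g"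
    using Suc.prems
    by (intro net_poly.mult[where m = 0] net_poly.mult[where m = "Suc 0"] net_poly_sum
        net_poly.add net_poly.const net_poly.weight weight_coord_hidden g
        net_poly.mult[where m = 0 and m' = 0, simplified] net_poly.unit) auto
  moreover have "has_axis_deriv i (\<lambda>(\<theta> :: ('d1, 'w, 'd2) param) x. hidden (Suc l) \<theta> x $ j) ?g"
    unfolding has_axis_deriv_def hidden_nth
    by (auto intro!: derivative_eq_intros d[unfolded has_axis_deriv_def, rule_format]
        simp: power2_eq_square mult.commute)
  ultimately show ?case by auto
qed

text \<open>A derivative costs at most \<open>H\<close> further weight factors, since by the product rule it falls on a single
unit of one of the \<open>H\<close> hidden layers.\<close>

lemma net_poly_deriv:
  fixes g :: "('d1::finite, 'w::finite, 'd2::finite) param \<Rightarrow> real ^ 'd1 \<Rightarrow> real"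
  assumes "net_poly H m g"
  shows "\<exists>g'. net_poly H (m + H) g' \<and> has_axis_deriv i g g'"
  using assms
proof (induction rule: net_poly.induct)
  case (const m c)
  show ?case by (intro exI[of _ "\<lambda>\<theta> x. 0"]) (auto intro: net_poly.const simp: has_axis_deriv_def)
next
  case (unit l m j)
  then obtain g' where "net_poly H (Suc l) g'"
    "has_axis_deriv i (\<lambda>(\<theta> :: ('d1, 'w, 'd2) param) x. hidden l \<theta> x $ j) g'"
    using hidden_deriv[of l H i j] by blast
  moreover from this(1) have "net_poly H (m + H) g'"
    by (rule net_poly_raise) (use unit in simp)
  ultimately show ?case by blast
next
  case (weight w m)
  show ?case by (intro exI[of _ "\<lambda>\<theta> x. 0"]) (auto intro: net_poly.const simp: has_axis_deriv_def)
next
  case (add m g k)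
  then obtain g' k' where "net_poly H (m + H) g'" "has_axis_deriv i g g'"
    "net_poly H (m + H) k'" "has_axis_deriv i k k'" by blast
  then show ?case using has_axis_deriv_add net_poly.add by blast
next
  case (mult m g n k)
  then obtain g' k' where *: "net_poly H (m + H) g'" "has_axis_deriv i g g'"
    "net_poly H (n + H) k'" "has_axis_deriv i k k'" by blast
  have "net_poly H ((m + H) + n) (\<lambda>\<theta> x. g' \<theta> x * k \<theta> x)" "net_poly H (m + (n + H)) (\<lambda>\<theta> x. g \<theta> x * k' \<theta> x)"
    using * mult by (auto intro: net_poly.mult simp del: add.assoc)
  then have "net_poly H (m + n + H) (\<lambda>\<theta> x. g' \<theta> x * k \<theta> x + g \<theta> x * k' \<theta> x)"
    by (intro net_poly.add) (simp_all add: ac_simps)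
  with has_axis_deriv_mult[OF *(2,4)] show ?case by blast
qed

lemma has_axis_derivD:
  "has_axis_deriv i g g' \<Longrightarrow> ((\<lambda>t. g \<theta> (x + t *\<^sub>R axis i 1)) has_vector_derivative g' \<theta> x) (at 0)"
  unfolding has_axis_deriv_def has_real_derivative_iff_has_vector_derivative by blast

lemma partial_deriv_eq:
  assumes "has_axis_deriv i g g'"
  shows "partial_deriv i (g \<theta>) = g' \<theta>"
proof
  show "partial_deriv i (g \<theta>) x = g' \<theta> x" for x
    unfolding partial_deriv_def by (rule vector_derivative_at[OF has_axis_derivD[OF assms]])
qed

text \<open>The regularity class of the domain of a polynomial operator is formulated with partial derivatives of
vector-valued functions, which are reduced here to those of the components.\<close>

definition vec_net_poly ::
    "nat \<Rightarrow> nat \<Rightarrow> (('d1::finite, 'w::finite, 'd2::finite) param \<Rightarrow> real ^ 'd1 \<Rightarrow> real ^ 'd2) \<Rightarrow> bool" where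
  "vec_net_poly H m F \<longleftrightarrow> (\<forall>j. net_poly H m (\<lambda>\<theta> x. F \<theta> x $ j))"

lemma vec_net_poly_deriv:
  fixes F :: "('d1::finite, 'w::finite, 'd2::finite) param \<Rightarrow> real ^ 'd1 \<Rightarrow> real ^ 'd2"
  assumes "vec_net_poly H m F"
  shows "vec_net_poly H (m + H) (\<lambda>\<theta>. partial_deriv i (F \<theta>))"
    and "(\<lambda>t. F \<theta> (x + t *\<^sub>R axis i 1)) differentiable (at (0::real))"
proof -
  have "\<forall>j. \<exists>g. net_poly H (m + H) g \<and> has_axis_deriv i (\<lambda>\<theta> x. F \<theta> x $ j) g"
    using assms net_poly_deriv unfolding vec_net_poly_def by blast
  from choice[OF this] obtain g where g: "\<And>j. net_poly H (m + H) (g j)"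
    and d: "\<And>j. has_axis_deriv i (\<lambda>\<theta> x. F \<theta> x $ j) (g j)" by blast
  have vd: "((\<lambda>t. F \<theta> (x + t *\<^sub>R axis i 1)) has_vector_derivative (\<chi> j. g j \<theta> x)) (at 0)" for \<theta> x
  proof -
    have "((\<lambda>t. F \<theta> (x + t *\<^sub>R axis i 1) $ j) has_derivative (\<lambda>h. (h *\<^sub>R (\<chi> j. g j \<theta> x)) $ j)) (at 0)" for j
      using has_axis_derivD[OF d[of j], of \<theta> x] by (simp add: has_vector_derivative_def)
    then show ?thesis
      unfolding has_vector_derivative_def
      by (subst has_derivative_componentwise_within) (auto simp: Basis_vec_def inner_axis)
  qed
  then have e: "partial_deriv i (F \<theta>) x = (\<chi> j. g j \<theta> x)" for \<theta> x
    unfolding partial_deriv_def by (rule vector_derivative_at)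
  show "vec_net_poly H (m + H) (\<lambda>\<theta>. partial_deriv i (F \<theta>))"
    using g by (simp add: vec_net_poly_def e)
  show "(\<lambda>t. F \<theta> (x + t *\<^sub>R axis i 1)) differentiable (at 0)"
    using vd unfolding has_vector_derivative_def differentiable_def by blast
qed

lemma coords_props: "distinct (coords :: 'd::finite list)" "set (coords :: 'd list) = UNIV"
proof -
  have "\<exists>xs :: 'd list. distinct xs \<and> set xs = UNIV"
    using finite_distinct_list[of "UNIV :: 'd set"] by auto
  from someI_ex[OF this] show "distinct (coords :: 'd list)" "set (coords :: 'd list) = UNIV"
    by (auto simp: coords_def)
qed

lemma mi_order_eq_sum_list: "mi_order \<alpha> = sum_list (map \<alpha> coords)"
  using sum.distinct_set_conv_list[OF coords_props(1), of \<alpha>] by (simp add: mi_order_def coords_props(2))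

lemma vec_net_poly_multi_deriv:
  assumes "vec_net_poly H m F"
  shows "vec_net_poly H (m + H * mi_order \<alpha>) (\<lambda>\<theta>. multi_deriv \<alpha> (F \<theta>))"
proof -
  have pow: "vec_net_poly H (m + H * k) (\<lambda>\<theta>. (partial_deriv i ^^ k) (F \<theta>))"
    if "vec_net_poly H m F" for i k m and F :: "('a, 'b, 'c) param \<Rightarrow> real ^ 'a \<Rightarrow> real ^ 'c"
    using that by (induction k) (auto simp: algebra_simps dest: vec_net_poly_deriv(1))
  have "vec_net_poly H (m + H * sum_list (map \<alpha> is))
      (\<lambda>\<theta>. foldr (\<lambda>i. partial_deriv i ^^ \<alpha> i) is (F \<theta>))" for "is"
  proof (induction "is")
    case (Cons i "is")
    from pow[OF this, of "\<alpha> i" i] show ?case by (simp add: algebra_simps)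
  qed (use assms in simp)
  then show ?thesis by (simp add: multi_deriv_def mi_order_eq_sum_list)
qed

lemma net_poly_multi_deriv:
  fixes g :: "('d1::finite, 'w::finite, 'd2::finite) param \<Rightarrow> real ^ 'd1 \<Rightarrow> real"
  assumes "net_poly H m g"
  shows "net_poly H (m + H * mi_order \<alpha>) (\<lambda>\<theta>. multi_deriv \<alpha> (g \<theta>))"
proof -
  have pow: "net_poly H (m + H * k) (\<lambda>\<theta>. (partial_deriv i ^^ k) (g \<theta>))"
    if "net_poly H m g" for i k m and g :: "('d1, 'w, 'd2) param \<Rightarrow> real ^ 'd1 \<Rightarrow> real"
    using that
  proof (induction k)
    case (Suc k)
    from net_poly_deriv[OF Suc.IH[OF that]]
    obtain g' where "net_poly H (m + H * k + H) g'"
      and d: "has_axis_deriv i (\<lambda>\<theta>. (partial_deriv i ^^ k) (g \<theta>)) g'" by blast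
    then show ?case by (simp add: algebra_simps partial_deriv_eq[OF d])
  qed simp
  have "net_poly H (m + H * sum_list (map \<alpha> is))
      (\<lambda>\<theta>. foldr (\<lambda>i. partial_deriv i ^^ \<alpha> i) is (g \<theta>))" for "is"
  proof (induction "is")
    case (Cons i "is")
    from pow[OF this, of "\<alpha> i" i] show ?case by (simp add: algebra_simps)
  qed (use assms in simp)
  then show ?thesis by (simp add: multi_deriv_def mi_order_eq_sum_list)
qed

lemma continuous_on_vec_net_poly:
  assumes "vec_net_poly H m F" and "\<theta> \<in> param_space H" and "bounded S"
  shows "continuous_on S (F \<theta>)"
proof -
  have "continuous_on S (\<lambda>x. F \<theta> x $ j)" for j
    using tame_net_poly[OF assms(3), of H m "\<lambda>\<theta> x. F \<theta> x $ j"] assms(1,2)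
    by (auto simp: vec_net_poly_def tame_def)
  then have "continuous_on S (\<lambda>x. \<chi> j. F \<theta> x $ j)" by (rule continuous_on_vec_lambda)
  then show ?thesis by simp
qed

lemma exists_bounded_param: "\<exists>\<rho>\<ge>1. bounded_param \<rho> \<theta>"
  by (rule exI[of _ "max 1 (param_norm \<theta>)"]) (auto intro: bounded_param_of_param_norm)

lemma vec_net_poly_bounded_on:
  assumes "vec_net_poly H m F" and "\<theta> \<in> param_space H" and "bounded S"
  shows "\<exists>B. \<forall>x\<in>S. norm (F \<theta> x) \<le> B"
proof -
  obtain \<rho> where \<rho>: "\<rho> \<ge> 1" "bounded_param \<rho> \<theta>" using exists_bounded_param by blast
  have "\<exists>B. \<forall>x\<in>S. \<bar>F \<theta> x $ j\<bar> \<le> B" for j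
  proof -
    have "tame H S m (\<lambda>\<theta> x. F \<theta> x $ j)"
      using assms(1) by (intro tame_net_poly[OF assms(3)]) (simp add: vec_net_poly_def)
    then obtain C where "\<And>x. x \<in> S \<Longrightarrow> \<bar>F \<theta> x $ j\<bar> \<le> C * \<rho> ^ m"
      using \<rho> assms(2) by (rule_tac tameE) blast+
    then show ?thesis by blast
  qed
  then obtain B where B: "\<And>j x. x \<in> S \<Longrightarrow> \<bar>F \<theta> x $ j\<bar> \<le> B j" by metis
  have "norm (F \<theta> x) \<le> (\<Sum>j\<in>UNIV. B j)" if "x \<in> S" for x
    using norm_le_l1_cart[of "F \<theta> x"] sum_mono[of UNIV "\<lambda>j. \<bar>F \<theta> x $ j\<bar>" B] B[OF that] by fastforce
  then show ?thesis by blast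
qed

lemma Ck_on_vec_net_poly:
  assumes "vec_net_poly H m F" and "\<theta> \<in> param_space H" and "bounded S"
  shows "Ck_on K S (F \<theta>)"
  using assms(1)
proof (induction K arbitrary: m F)
  case 0
  then show ?case using continuous_on_vec_net_poly[OF 0 assms(2,3)] by simp
next
  case (Suc K)
  then show ?case
    using continuous_on_vec_net_poly[OF Suc.prems assms(2,3)] vec_net_poly_deriv(1,2)[OF Suc.prems] by auto
qed

lemma finite_mi_order_le: "finite {\<alpha> :: 'd::finite \<Rightarrow> nat. mi_order \<alpha> \<le> K}"
proof (rule finite_subset)
  show "{\<alpha> :: 'd \<Rightarrow> nat. mi_order \<alpha> \<le> K} \<subseteq> PiE UNIV (\<lambda>_. {..K})"
  proof
    fix \<alpha> :: "'d \<Rightarrow> nat" assume "\<alpha> \<in> {\<alpha>. mi_order \<alpha> \<le> K}"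
    moreover have "\<alpha> i \<le> mi_order \<alpha>" for i unfolding mi_order_def by (rule member_le_sum) auto
    ultimately show "\<alpha> \<in> PiE UNIV (\<lambda>_. {..K})" by (auto intro: order_trans)
  qed
qed (auto intro: finite_PiE)

section \<open>The integrands of the risks\<close>

text \<open>Polynomial operators are specified only on \<open>C\<^sup>K\<close> of the closure, so this is what allows them to be
evaluated by their formula on networks.\<close>

lemma Ck_closure_network:
  fixes \<theta> :: "('d1::finite, 'w::finite, 'd2::finite) param"
  assumes "\<theta> \<in> param_space H" and "bounded \<Omega>" and "H \<ge> 1"
  shows "Ck_closure K \<Omega> (network \<theta>)"
proof -
  let ?F = "network_total H :: ('d1, 'w, 'd2) param \<Rightarrow> _"
  have v: "vec_net_poly H 1 ?F" using net_poly_network[OF assms(3)] by (auto simp: vec_net_poly_def)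
  have "\<exists>B. \<forall>x\<in>\<Omega>. norm (multi_deriv \<alpha> (?F \<theta>) x) \<le> B" for \<alpha>
    by (rule vec_net_poly_bounded_on[OF vec_net_poly_multi_deriv[OF v] assms(1,2)])
  then obtain B where B: "\<And>\<alpha> x. x \<in> \<Omega> \<Longrightarrow> norm (multi_deriv \<alpha> (?F \<theta>) x) \<le> B \<alpha>" by metis
  have "Ck_norm K \<Omega> (?F \<theta>) \<le> (\<Sum>\<alpha>\<in>{\<alpha>. mi_order \<alpha> \<le> K}. ennreal (B \<alpha>))"
    unfolding Ck_norm_def
  proof (intro SUP_least)
    fix \<alpha> :: "'d1 \<Rightarrow> nat" and x assume a: "\<alpha> \<in> {\<alpha>. mi_order \<alpha> \<le> K}" and x: "x \<in> \<Omega>"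
    have "ennreal (infnorm (multi_deriv \<alpha> (?F \<theta>) x)) \<le> ennreal (B \<alpha>)"
      using B[OF x] infnorm_le_norm order_trans by (blast intro: ennreal_leI)
    also have "\<dots> \<le> (\<Sum>\<alpha>\<in>{\<alpha>. mi_order \<alpha> \<le> K}. ennreal (B \<alpha>))"
      by (rule member_le_sum[OF a _ finite_mi_order_le]) auto
    finally show "ennreal (infnorm (multi_deriv \<alpha> (?F \<theta>) x)) \<le> (\<Sum>\<alpha>\<in>{\<alpha>. mi_order \<alpha> \<le> K}. ennreal (B \<alpha>))" .
  qed
  also have "\<dots> < \<infinity>" by (simp add: finite_mi_order_le)
  finally show ?thesis
    using continuous_on_vec_net_poly[OF v assms(1) bounded_closure[OF assms(2)]]
      Ck_on_vec_net_poly[OF v assms(1,2)]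
    by (simp add: Ck_closure_def network_eq_network_total[OF assms(1)])
qed

lemma Cinf_closure_bounded:
  fixes \<phi> :: "real ^ 'd1::finite \<Rightarrow> real"
  assumes "Cinf_closure \<Omega> \<phi>"
  shows "\<exists>B. \<forall>x\<in>\<Omega>. \<bar>\<phi> x\<bar> \<le> B"
proof -
  have fin: "Ck_norm 0 \<Omega> \<phi> < \<infinity>" using assms by (simp add: Cinf_closure_def)
  have m0: "multi_deriv (\<lambda>_. 0) \<phi> = \<phi>"
  proof -
    have "foldr (\<lambda>i. partial_deriv i ^^ 0) is \<phi> = \<phi>" for "is" by (induction "is") auto
    then show ?thesis by (simp add: multi_deriv_def)
  qed
  have "ennreal \<bar>\<phi> x\<bar> \<le> Ck_norm 0 \<Omega> \<phi>" if "x \<in> \<Omega>" for x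
  proof -
    have "ennreal (infnorm (multi_deriv (\<lambda>_. 0) \<phi> x)) \<le> Ck_norm 0 \<Omega> \<phi>"
      unfolding Ck_norm_def using that
      by (intro SUP_upper2[of "\<lambda>_. 0"] SUP_upper) (auto simp: mi_order_def)
    then show ?thesis by (simp add: m0 infnorm_def)
  qed
  then have "\<bar>\<phi> x\<bar> \<le> enn2real (Ck_norm 0 \<Omega> \<phi>)" if "x \<in> \<Omega>" for x
    using enn2real_mono[of "ennreal \<bar>\<phi> x\<bar>" "Ck_norm 0 \<Omega> \<phi>"] fin that by auto
  then show ?thesis by blast
qed

text \<open>A derivative of order \<open>|\<alpha>|\<close> of a network has growth exponent \<open>1 + H |\<alpha>| \<le> H (1 + |\<alpha>|)\<close>, and exponents add
up in products. The weights \<open>1 + |\<alpha>|\<close> in the definition of the degree match this count, whence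
the exponent \<open>H d\<close>.\<close>

lemma tame_polynomial_operator:
  fixes \<F> :: "(real ^ 'd1::finite \<Rightarrow> real ^ 'd2::finite) \<Rightarrow> real ^ 'd1 \<Rightarrow> real"
  assumes "polynomial_operator \<Omega> K \<F> d" and "bounded \<Omega>" and "H \<ge> 1"
  shows "\<exists>G. tame H \<Omega> (H * d) G \<and>
    (\<forall>(\<theta> :: ('d1, 'w::finite, 'd2) param) \<in> param_space H. \<forall>x\<in>\<Omega>. \<F> (network \<theta>) x = G \<theta> x)"
proof -
  from assms(1) obtain s N and \<alpha> :: "'d2 \<Rightarrow> nat \<Rightarrow> 'd1 \<Rightarrow> nat" and \<phi> and I :: "'d2 \<Rightarrow> nat \<Rightarrow> nat \<Rightarrow> nat"
    where \<phi>: "\<And>r. r < N \<Longrightarrow> Cinf_closure \<Omega> (\<phi> r)"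
      and \<F>: "\<And>u x. Ck_closure K \<Omega> u \<Longrightarrow> x \<in> \<Omega> \<Longrightarrow> \<F> u x = (\<Sum>r<N. \<phi> r x *
             (\<Prod>i\<in>UNIV. \<Prod>j<s. (multi_deriv (\<alpha> i j) (\<lambda>y. u y $ i) x) ^ I i j r))"
      and d: "d = Max ((\<lambda>r. \<Sum>i\<in>UNIV. \<Sum>j<s. (1 + mi_order (\<alpha> i j)) * I i j r) ` {..<N})"
    unfolding polynomial_operator_def by blast
  let ?D = "\<lambda>i j (\<theta> :: ('d1, 'w, 'd2) param) x. multi_deriv (\<alpha> i j) (\<lambda>y. network_total H \<theta> y $ i) x"
  let ?G = "\<lambda>(\<theta> :: ('d1, 'w, 'd2) param) x. \<Sum>r<N. \<phi> r x * (\<Prod>i\<in>UNIV. \<Prod>j<s. ?D i j \<theta> x ^ I i j r)"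
  have D: "tame H \<Omega> (H * (1 + mi_order (\<alpha> i j))) (?D i j)" for i j
  proof (rule tame_mono)
    show "tame H \<Omega> (1 + H * mi_order (\<alpha> i j)) (?D i j)"
      using tame_net_poly[OF assms(2) net_poly_multi_deriv[OF net_poly_network[OF assms(3), where j = i]]] .
    show "1 + H * mi_order (\<alpha> i j) \<le> H * (1 + mi_order (\<alpha> i j))" using assms(3) by simp
  qed
  have "tame H \<Omega> (H * d) ?G"
  proof (rule tame_sum)
    fix r assume r: "r \<in> {..<N}"
    obtain B where "\<And>x. x \<in> \<Omega> \<Longrightarrow> \<bar>\<phi> r x\<bar> \<le> B" using Cinf_closure_bounded[OF \<phi>] r by blast
    moreover have "continuous_on \<Omega> (\<phi> r)"
      using \<phi>[of r] r continuous_on_subset[OF _ closure_subset] by (auto simp: Cinf_closure_def)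
    ultimately have "tame H \<Omega> 0 (\<lambda>(\<theta> :: ('d1, 'w, 'd2) param). \<phi> r)" by (intro tame_const)
    moreover have "tame H \<Omega> (\<Sum>i\<in>UNIV. \<Sum>j<s. H * (1 + mi_order (\<alpha> i j)) * I i j r)
        (\<lambda>\<theta> x. \<Prod>i\<in>UNIV. \<Prod>j<s. ?D i j \<theta> x ^ I i j r)"
      by (intro tame_prod tame_power D) auto
    ultimately have "tame H \<Omega> (0 + (\<Sum>i\<in>UNIV. \<Sum>j<s. H * (1 + mi_order (\<alpha> i j)) * I i j r))
        (\<lambda>\<theta> x. \<phi> r x * (\<Prod>i\<in>UNIV. \<Prod>j<s. ?D i j \<theta> x ^ I i j r))" by (rule tame_mult)
    moreover have "0 + (\<Sum>i\<in>UNIV. \<Sum>j<s. H * (1 + mi_order (\<alpha> i j)) * I i j r) \<le> H * d"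
    proof -
      have "(\<Sum>i\<in>UNIV. \<Sum>j<s. (1 + mi_order (\<alpha> i j)) * I i j r) \<le> d"
        unfolding d using r by (intro Max_ge) auto
      then show ?thesis by (simp add: sum_distrib_left[symmetric] mult.assoc del: mult_Suc mult_Suc_right)
    qed
    ultimately show "tame H \<Omega> (H * d) (\<lambda>\<theta> x. \<phi> r x * (\<Prod>i\<in>UNIV. \<Prod>j<s. ?D i j \<theta> x ^ I i j r))"
      by (rule tame_mono)
  qed
  moreover have "\<F> (network \<theta>) x = ?G \<theta> x" if "\<theta> \<in> param_space H" "x \<in> \<Omega>" for \<theta> :: "('d1, 'w, 'd2) param" and x
    using \<F>[OF Ck_closure_network[OF that(1) assms(2,3)] that(2)] by (simp add: network_eq_network_total[OF that(1)])
  ultimately show ?thesis by blast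
qed

lemma tame_squared_misfit:
  fixes h :: "real ^ 'd1::finite \<Rightarrow> real ^ 'd2::finite"
  assumes "bounded E" and "L-lipschitz_on E h" and "H \<ge> 1"
  shows "tame H E 2 (\<lambda>(\<theta> :: ('d1, 'w::finite, 'd2) param) x. (norm (network_total H \<theta> x - h x))\<^sup>2)"
proof -
  have hc: "continuous_on E h" using assms(2) by (rule lipschitz_on_continuous_on)
  obtain R where R: "\<And>x. x \<in> E \<Longrightarrow> norm x \<le> R" using assms(1) by (auto simp: bounded_iff)
  have "\<exists>B. \<forall>x\<in>E. norm (h x) \<le> B"
  proof (cases "E = {}")
    case False
    then obtain z where z: "z \<in> E" by blast
    have "norm (h x) \<le> norm (h z) + L * (R + R)" if x: "x \<in> E" for x
    proof -
      have "dist (h x) (h z) \<le> L * dist x z" using lipschitz_onD[OF assms(2) x z] .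
      also have "\<dots> \<le> L * (R + R)"
        using lipschitz_on_nonneg[OF assms(2)] R[OF x] R[OF z] norm_triangle_ineq4[of x z]
        by (intro mult_left_mono) (auto simp: dist_norm)
      finally show ?thesis using norm_triangle_ineq2[of "h x" "h z"] by (simp add: dist_norm)
    qed
    then show ?thesis by blast
  qed simp
  then obtain B where B: "\<And>x. x \<in> E \<Longrightarrow> norm (h x) \<le> B" by blast
  have misfit: "tame H E 1 (\<lambda>(\<theta> :: ('d1, 'w, 'd2) param) x. network_total H \<theta> x $ j + - (h x $ j))" for j
  proof (rule tame_add)
    show "tame H E 1 (\<lambda>(\<theta> :: ('d1, 'w, 'd2) param) x. network_total H \<theta> x $ j)"
      by (rule tame_net_poly[OF assms(1) net_poly_network[OF assms(3)]])
    show "tame H E 1 (\<lambda>(\<theta> :: ('d1, 'w, 'd2) param) x. - (h x $ j))"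
    proof (rule tame_mono[OF tame_const[where C = B]])
      show "continuous_on E (\<lambda>x. - (h x $ j))" by (intro continuous_intros hc)
      show "\<bar>- (h x $ j)\<bar> \<le> B" if "x \<in> E" for x
        using B[OF that] component_le_norm_cart[of "h x" j] by simp
    qed simp
  qed
  then have "tame H E 2 (\<lambda>(\<theta> :: ('d1, 'w, 'd2) param) x. (network_total H \<theta> x $ j + - (h x $ j))\<^sup>2)" for j
    using tame_power[OF misfit[of j], of 2] by (simp only: mult_1)
  then have "tame H E 2 (\<lambda>(\<theta> :: ('d1, 'w, 'd2) param) x. \<Sum>j\<in>UNIV. (network_total H \<theta> x $ j + - (h x $ j))\<^sup>2)"
    by (rule tame_sum)
  moreover have "(norm v)\<^sup>2 = (\<Sum>j\<in>UNIV. (v $ j)\<^sup>2)" for v :: "real ^ 'd2"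
    by (simp add: norm_vec_def L2_set_def sum_nonneg)
  ultimately show ?thesis by simp
qed

section \<open>A uniform law of large numbers over growing classes\<close>

lemma filterlim_nat_powr_at_top:
  assumes "r > 0"
  shows "filterlim (\<lambda>n. real n powr r) at_top sequentially"
  unfolding filterlim_at_top
proof
  fix Z :: real
  have "eventually (\<lambda>n. (max 1 Z) powr (1 / r) \<le> real n) sequentially"
    using filterlim_real_sequentially by (auto simp: filterlim_at_top)
  then show "eventually (\<lambda>n. Z \<le> real n powr r) sequentially"
  proof eventually_elim
    case (elim n)
    have "Z \<le> (max 1 Z powr (1 / r)) powr r" using assms by (simp add: powr_powr)
    also have "\<dots> \<le> real n powr r" using elim assms by (intro powr_mono2) auto
    finally show ?case .
  qed
qed

text \<open>The probabilities of large deviations on a net of polynomial cardinality are of this form, and their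
summability is the hypothesis of the Borel-Cantelli lemma.\<close>

lemma summable_power_mult_exp:
  fixes c r :: real
  assumes "c > 0" and "r > 0"
  shows "summable (\<lambda>n. real n ^ q * exp (- (c * real n powr r)))"
proof -
  \<comment> \<open>The \<open>k\<close>-th power of \<open>c n\<^sup>r\<close> dominates \<open>n\<^sup>q\<^sup>+\<^sup>2\<close>, and the exponential dominates every power.\<close>
  obtain k :: nat where k: "real (q + 2) / r \<le> real k" using real_arch_simple by blast
  then have rk: "real (q + 2) \<le> r * real k" using assms by (simp add: field_simps)
  have "filterlim (\<lambda>n. c * real n powr r) at_top sequentially"
    by (rule filterlim_tendsto_pos_mult_at_top[OF tendsto_const assms(1) filterlim_nat_powr_at_top[OF assms(2)]])
  from filterlim_compose[OF tendsto_power_div_exp_0 this]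
  have "((\<lambda>n. (c * real n powr r) ^ k / exp (c * real n powr r)) \<longlonglongrightarrow> 0)" .
  then have "eventually (\<lambda>n. (c * real n powr r) ^ k / exp (c * real n powr r) < 1) sequentially"
    by (rule order_tendstoD) simp
  then have "eventually (\<lambda>n. norm (real n ^ q * exp (- (c * real n powr r))) \<le> inverse (c ^ k) * inverse (real n ^ 2)) sequentially"
    using eventually_ge_at_top[of 1]
  proof eventually_elim
    case (elim n)
    then have n: "real n \<ge> 1" "real n > 0" by auto
    have "(c * real n powr r) ^ k \<le> exp (c * real n powr r)"
      using elim by (simp add: divide_simps split: if_splits)
    moreover have "(c * real n powr r) ^ k = c ^ k * real n powr (r * real k)"
      using n by (simp add: power_mult_distrib powr_power mult.commute)
    moreover have "c ^ k * real n powr (q + 2) \<le> c ^ k * real n powr (r * real k)"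
      using rk n assms(1) by (intro mult_left_mono powr_mono) auto
    moreover have "real n powr (q + 2) = real n ^ q * real n ^ 2"
      using powr_realpow[OF n(2), of "q + 2"] by (simp only: power_add)
    ultimately have "c ^ k * (real n ^ q * real n ^ 2) \<le> exp (c * real n powr r)"
      by simp
    then have "real n ^ q / exp (c * real n powr r) \<le> inverse (c ^ k) * inverse (real n ^ 2)"
      using assms(1) n by (simp add: field_simps)
    then show ?case by (simp add: exp_minus divide_inverse)
  qed
  then show ?thesis
    by (rule summable_comparison_test_ev) (intro summable_mult inverse_power_summable, simp)
qed

text \<open>Hoeffding's inequality, with the expectation written as an integral over the common law.\<close>

lemma iid_deviation_bound:
  fixes f :: "'x \<Rightarrow> real"
  assumes "prob_space P" and "iid P N Z UNIV \<mu>" and "f \<in> borel_measurable N"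
    and "\<And>z. z \<in> space N \<Longrightarrow> \<bar>f z\<bar> \<le> B" and "B > 0" and "n \<ge> 1" and "e \<ge> 0"
  shows "measure P {\<omega> \<in> space P. \<bar>(\<Sum>i<n. f (Z i \<omega>)) / real n - (LINT z|\<mu>. f z)\<bar> \<ge> e}
    \<le> 2 * exp (- (2 * real n * e\<^sup>2 / (2 * B)\<^sup>2))"
proof -
  interpret prob_space P by fact
  have ind: "indep_vars (\<lambda>_. N) Z UNIV" and D: "\<And>i. distr P N (Z i) = \<mu>"
    using assms(2) by (auto simp: iid_def)
  have Z: "Z i \<in> measurable P N" for i using ind by (auto simp: indep_vars_def)
  note [measurable] = Z assms(3)
  interpret Hoeffding_ineq_iid P "{..<n}" "\<lambda>i \<omega>. f (Z i \<omega>)" "\<lambda>\<omega>. f (Z 0 \<omega>)" "- B" B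
    "expectation (\<lambda>\<omega>. f (Z 0 \<omega>))"
  proof unfold_locales
    show "indep_vars (\<lambda>_. borel) (\<lambda>i \<omega>. f (Z i \<omega>)) {..<n}"
      by (rule indep_vars_compose2[OF indep_vars_subset[OF ind]]) (use assms(3) in auto)
    show "distr P borel (\<lambda>\<omega>. f (Z i \<omega>)) = distr P borel (\<lambda>\<omega>. f (Z 0 \<omega>))" for i
      using distr_distr[OF assms(3) Z[of i]] distr_distr[OF assms(3) Z[of 0]] D by (simp add: o_def)
    show "AE \<omega> in P. f (Z 0 \<omega>) \<in> {- B..B}"
    proof (rule AE_I2)
      fix \<omega> assume "\<omega> \<in> space P"
      then have "Z 0 \<omega> \<in> space N" by (rule measurable_space[OF Z])
      from assms(4)[OF this] show "f (Z 0 \<omega>) \<in> {- B..B}" by auto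
    qed
  qed auto
  have E: "expectation (\<lambda>\<omega>. f (Z 0 \<omega>)) = (LINT z|\<mu>. f z)"
    using integral_distr[OF Z[of 0] assms(3)] D by simp
  have "{..<n} \<noteq> {}" using assms(6) by (simp add: lessThan_empty_iff)
  from Hoeffding_ineq_abs_ge'[OF assms(7) _ this] assms(5) show ?thesis by (simp add: E)
qed

text \<open>For one function bounded by \<open>C n\<^sup>s\<close>, the mean of \<open>n\<close> samples deviates from its expectation by more than
\<open>\<epsilon>\<close> with probability at most \<open>2 exp (- c n\<^sup>r)\<close>, where \<open>r = 1 - 2 s\<close>. This beats every polynomial in \<open>n\<close>
precisely when \<open>s < 1/2\<close>, hence a union bound over the polynomially many functions in the net \<open>F n\<close>
remains summable, and almost surely all of them converge simultaneously. Approximation within \<open>C / n\<close>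
transfers this to the class \<open>T n\<close>, which may grow with \<open>n\<close>.\<close>

lemma uniform_law_via_finite_nets:
  fixes f :: "'t \<Rightarrow> 'x \<Rightarrow> real" and T F :: "nat \<Rightarrow> 't set"
  assumes P: "prob_space P" and iid: "iid P N Z UNIV \<mu>"
    and T_meas: "\<And>n t. n \<ge> 1 \<Longrightarrow> t \<in> T n \<Longrightarrow> f t \<in> borel_measurable N"
    and C: "C > 0" and s: "s < 1/2"
    and fin: "\<And>n. n \<ge> 1 \<Longrightarrow> finite (F n)"
    and card: "\<And>n. n \<ge> 1 \<Longrightarrow> real (card (F n)) \<le> C * real n ^ q"
    and F_meas: "\<And>n t. n \<ge> 1 \<Longrightarrow> t \<in> F n \<Longrightarrow> f t \<in> borel_measurable N"
    and bound: "\<And>n t z. n \<ge> 1 \<Longrightarrow> t \<in> F n \<Longrightarrow> z \<in> space N \<Longrightarrow> \<bar>f t z\<bar> \<le> C * real n powr s"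
    and net: "\<And>n t. n \<ge> 1 \<Longrightarrow> t \<in> T n \<Longrightarrow> \<exists>t'\<in>F n. \<forall>z\<in>space N. \<bar>f t z - f t' z\<bar> \<le> C / real n"
  shows "AE \<omega> in P. \<forall>\<epsilon>>0. \<exists>n0\<ge>1. \<forall>n\<ge>n0. \<forall>t\<in>T n.
    \<bar>(\<Sum>i<n. f t (Z i \<omega>)) / real n - (LINT z|\<mu>. f t z)\<bar> < \<epsilon>"
proof -
  interpret prob_space P by fact
  have ind: "indep_vars (\<lambda>_. N) Z UNIV" and D: "\<And>i. distr P N (Z i) = \<mu>"
    using iid by (auto simp: iid_def)
  have Z[measurable]: "Z i \<in> measurable P N" for i using ind by (auto simp: indep_vars_def)
  have "prob_space (distr P N (Z 0))" by (rule prob_space_distr) simp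
  then interpret mu: prob_space \<mu> using D by simp
  have sets_mu: "sets \<mu> = sets N" using D[of 0] by (metis sets_distr)
  have space_mu: "space \<mu> = space N" using sets_mu by (rule sets_eq_imp_space_eq)
  let ?dev = "\<lambda>n t \<omega>. \<bar>(\<Sum>i<n. f t (Z i \<omega>)) / real n - (LINT z|\<mu>. f t z)\<bar>"
  have nets: "AE \<omega> in P. \<exists>n0\<ge>1. \<forall>n\<ge>n0. \<forall>t\<in>F n. ?dev n t \<omega> < e" if e: "e > 0" for e
  proof -
    define bad where "bad n = (if n = 0 then {} else \<Union>t\<in>F n. {\<omega> \<in> space P. ?dev n t \<omega> \<ge> e})" for n
    have sets1: "{\<omega> \<in> space P. ?dev n t \<omega> \<ge> e} \<in> sets P" if "n \<ge> 1" "t \<in> F n" for n t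
    proof -
      note [measurable] = F_meas[OF that]
      show ?thesis by measurable
    qed
    have sets_bad: "bad n \<in> sets P" for n
    proof (cases "n = 0")
      case False
      then show ?thesis unfolding bad_def using sets1[of n] fin[of n] by (simp add: sets.finite_UN)
    qed (simp add: bad_def)
    define c where "c = e\<^sup>2 / (2 * C\<^sup>2)"
    have c: "c > 0" using e C by (simp add: c_def)
    have meas_bad: "measure P (bad n) \<le> (2 * C) * (real n ^ q * exp (- (c * real n powr (1 - 2 * s))))"
      if n: "n \<ge> 1" for n
    proof -
      have B: "C * real n powr s > 0" using C n by simp
      have ex: "2 * real n * e\<^sup>2 / (2 * (C * real n powr s))\<^sup>2 = c * real n powr (1 - 2 * s)"
      proof -
        have "real n powr (1 - 2 * s) = real n / (real n powr s)\<^sup>2"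
          using n by (simp add: powr_diff powr_power)
        then show ?thesis using C by (simp add: c_def power2_eq_square field_simps)
      qed
      have "measure P (bad n) \<le> (\<Sum>t\<in>F n. measure P {\<omega> \<in> space P. ?dev n t \<omega> \<ge> e})"
        using n sets1 fin[OF n] by (auto simp: bad_def intro!: finite_measure_subadditive_finite)
      also have "\<dots> \<le> (\<Sum>t\<in>F n. 2 * exp (- (c * real n powr (1 - 2 * s))))"
        using iid_deviation_bound[OF P iid F_meas[OF n] bound[OF n] B n less_imp_le[OF e]]
        unfolding ex by (rule sum_mono)
      also have "\<dots> = real (card (F n)) * (2 * exp (- (c * real n powr (1 - 2 * s))))" by simp
      also have "\<dots> \<le> (C * real n ^ q) * (2 * exp (- (c * real n powr (1 - 2 * s))))"
        using card[OF n] by (intro mult_right_mono) auto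
      finally show ?thesis by (simp add: algebra_simps)
    qed
    have "summable (\<lambda>n. measure P (bad n))"
    proof (rule summable_comparison_test_ev)
      show "eventually (\<lambda>n. norm (measure P (bad n))
          \<le> (2 * C) * (real n ^ q * exp (- (c * real n powr (1 - 2 * s))))) sequentially"
        using eventually_ge_at_top[of 1] by eventually_elim (use meas_bad in auto)
      show "summable (\<lambda>n. (2 * C) * (real n ^ q * exp (- (c * real n powr (1 - 2 * s)))))"
        using c s by (intro summable_mult summable_power_mult_exp) auto
    qed
    from borel_cantelli_AE1[OF sets_bad _ this]
    have "AE \<omega> in P. eventually (\<lambda>n. \<omega> \<in> space P - bad n) sequentially"
      by (simp add: emeasure_eq_measure)
    then show ?thesis
    proof (rule AE_mp, intro AE_I2 impI)
      fix \<omega> assume "\<omega> \<in> space P" and "eventually (\<lambda>n. \<omega> \<in> space P - bad n) sequentially"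
      then obtain n0 where n0: "\<And>n. n \<ge> n0 \<Longrightarrow> \<omega> \<in> space P - bad n" by (auto simp: eventually_sequentially)
      show "\<exists>n0\<ge>1. \<forall>n\<ge>n0. \<forall>t\<in>F n. ?dev n t \<omega> < e"
      proof (intro exI[of _ "max 1 n0"] conjI allI impI ballI)
        fix n t assume "n \<ge> max 1 n0" "t \<in> F n"
        with n0[of n] show "?dev n t \<omega> < e" by (auto simp: bad_def not_le)
      qed simp
    qed
  qed
  have "AE \<omega> in P. \<forall>k. \<exists>n0\<ge>1. \<forall>n\<ge>n0. \<forall>t\<in>F n. ?dev n t \<omega> < inverse (real (Suc k))"
    by (subst AE_all_countable) (intro allI nets, simp)
  then show ?thesis
  proof (rule AE_mp, intro AE_I2 impI allI)
    fix \<omega> and \<epsilon> :: real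
    assume \<omega>: "\<omega> \<in> space P" and k: "\<forall>k. \<exists>n0\<ge>1. \<forall>n\<ge>n0. \<forall>t\<in>F n. ?dev n t \<omega> < inverse (real (Suc k))"
      and \<epsilon>: "\<epsilon> > 0"
    from \<epsilon> obtain k where k': "inverse (real (Suc k)) < \<epsilon> / 3" using reals_Archimedean[of "\<epsilon> / 3"] by auto
    with k obtain n1 where n1: "n1 \<ge> 1" "\<And>n t. n \<ge> n1 \<Longrightarrow> t \<in> F n \<Longrightarrow> ?dev n t \<omega> < \<epsilon> / 3"
      by (meson order.strict_trans)
    obtain n2 :: nat where n2: "3 * C / \<epsilon> < real n2" using reals_Archimedean2 by blast
    have Zsp: "Z i \<omega> \<in> space N" for i using \<omega> by (rule measurable_space[OF Z])
    show "\<exists>n0\<ge>1. \<forall>n\<ge>n0. \<forall>t\<in>T n. ?dev n t \<omega> < \<epsilon>"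
    proof (intro exI[of _ "max n1 n2"] conjI allI impI ballI)
      show "1 \<le> max n1 n2" using n1(1) by simp
      fix n t assume "n \<ge> max n1 n2" and t: "t \<in> T n"
      then have n: "n \<ge> 1" "n \<ge> n1" "n \<ge> n2" using n1(1) by auto
      have "3 * C / \<epsilon> < real n" using n2 n(3) by linarith
      then have small: "C / real n < \<epsilon> / 3" using \<epsilon> n by (simp add: field_simps)
      from net[OF n(1) t] obtain t' where t': "t' \<in> F n"
        and d: "\<And>z. z \<in> space N \<Longrightarrow> \<bar>f t z - f t' z\<bar> \<le> C / real n" by blast
      have m: "f t \<in> borel_measurable \<mu>" "f t' \<in> borel_measurable \<mu>"
        using T_meas[OF n(1) t] F_meas[OF n(1) t'] by (simp_all add: measurable_cong_sets[OF sets_mu refl])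
      have i': "integrable \<mu> (f t')"
        using bound[OF n(1) t'] m by (intro mu.integrable_const_bound[where B = "C * real n powr s"]) (auto simp: space_mu)
      have i: "integrable \<mu> (f t)"
      proof (rule mu.integrable_const_bound[where B = "C * real n powr s + C / real n"])
        show "AE z in \<mu>. norm (f t z) \<le> C * real n powr s + C / real n"
        proof (rule AE_I2)
          fix z assume "z \<in> space \<mu>"
          then show "norm (f t z) \<le> C * real n powr s + C / real n"
            using bound[OF n(1) t', of z] d[of z] by (simp add: space_mu)
        qed
      qed (use m in simp)
      have "\<bar>(LINT z|\<mu>. f t z) - (LINT z|\<mu>. f t' z)\<bar> = \<bar>LINT z|\<mu>. f t z - f t' z\<bar>"
        using i i' by simp
      also have "\<dots> \<le> (LINT z|\<mu>. \<bar>f t z - f t' z\<bar>)" by (rule integral_abs_bound)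
      also have "\<dots> \<le> (LINT z|\<mu>. C / real n)"
        using i i' d by (intro integral_mono) (auto simp: space_mu)
      finally have d1: "\<bar>(LINT z|\<mu>. f t z) - (LINT z|\<mu>. f t' z)\<bar> \<le> C / real n" by (simp add: mu.prob_space)
      have "\<bar>(\<Sum>i<n. f t (Z i \<omega>)) - (\<Sum>i<n. f t' (Z i \<omega>))\<bar> \<le> (\<Sum>i<n. \<bar>f t (Z i \<omega>) - f t' (Z i \<omega>)\<bar>)"
        by (simp add: sum_subtractf[symmetric])
      also have "\<dots> \<le> (\<Sum>i<n. C / real n)" using d Zsp by (intro sum_mono) auto
      also have "\<dots> = C" using n by simp
      finally have "\<bar>(\<Sum>i<n. f t (Z i \<omega>)) - (\<Sum>i<n. f t' (Z i \<omega>))\<bar> / real n \<le> C / real n"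
        by (rule divide_right_mono) simp
      then have d2: "\<bar>(\<Sum>i<n. f t (Z i \<omega>)) / real n - (\<Sum>i<n. f t' (Z i \<omega>)) / real n\<bar> \<le> C / real n"
        by (simp add: diff_divide_distrib[symmetric])
      show "?dev n t \<omega> < \<epsilon>" using d1 d2 n1(2)[OF n(2) t'] small by linarith
    qed
  qed
qed

text \<open>The net is the grid of mesh \<open>1 / m\<close>, and a point is approximated by rounding its coordinates down.\<close>

lemma euclidean_ball_net:
  fixes m K :: nat
  assumes "m \<ge> 1" and "K \<ge> 1"
  shows "\<exists>G :: 'a::euclidean_space set. finite G \<and> card G \<le> (3 * m * K) ^ DIM('a) \<and>
    (\<forall>x. norm x \<le> real K \<longrightarrow> (\<exists>y\<in>G. norm (x - y) \<le> DIM('a) / real m))"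
proof -
  let ?A = "{- int (m * K)..int (m * K)}"
  let ?g = "\<lambda>k :: 'a \<Rightarrow> int. \<Sum>b\<in>Basis. (real_of_int (k b) / real m) *\<^sub>R b"
  let ?E = "PiE Basis (\<lambda>_ :: 'a. ?A)"
  have fE: "finite ?E" by (intro finite_PiE) auto
  have "card ?A = nat (int (2 * (m * K) + 1))" by (simp add: algebra_simps)
  also have "\<dots> = 2 * (m * K) + 1" by (rule nat_int)
  also have "\<dots> \<le> 3 * m * K" using assms by simp
  finally have cA: "card ?A \<le> 3 * m * K" .
  have "card (?g ` ?E) \<le> card ?E" using fE by (rule card_image_le)
  also have "\<dots> = card ?A ^ DIM('a)" by (simp add: card_PiE)
  also have "\<dots> \<le> (3 * m * K) ^ DIM('a)" using cA by (rule power_mono) simp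
  finally have c: "card (?g ` ?E) \<le> (3 * m * K) ^ DIM('a)" .
  have "\<exists>y\<in>?g ` ?E. norm (x - y) \<le> DIM('a) / real m" if x: "norm x \<le> real K" for x :: 'a
  proof -
    define k where "k = restrict (\<lambda>b. \<lfloor>real m * (x \<bullet> b)\<rfloor>) Basis"
    have "k \<in> ?E"
    proof
      fix b :: 'a assume b: "b \<in> Basis"
      have "\<bar>x \<bullet> b\<bar> \<le> real K" using Basis_le_norm[OF b] x by (rule order_trans)
      then have "real m * \<bar>x \<bullet> b\<bar> \<le> real m * real K" by (rule mult_left_mono) simp
      then have "\<bar>real m * (x \<bullet> b)\<bar> \<le> real (m * K)" by (simp add: abs_mult)
      then have "- real (m * K) \<le> real m * (x \<bullet> b)" "real m * (x \<bullet> b) \<le> real (m * K)" by linarith+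
      then have "real_of_int (- int (m * K)) \<le> real m * (x \<bullet> b)" "real m * (x \<bullet> b) \<le> real_of_int (int (m * K))"
        by simp_all
      then have "- int (m * K) \<le> \<lfloor>real m * (x \<bullet> b)\<rfloor>" "\<lfloor>real m * (x \<bullet> b)\<rfloor> \<le> int (m * K)"
        by (simp only: le_floor_iff, metis floor_mono floor_of_int)
      then show "k b \<in> ?A" using b by (simp add: k_def)
    qed (simp add: k_def)
    moreover have "norm (x - ?g k) \<le> DIM('a) / real m"
    proof -
      have "\<bar>(x - ?g k) \<bullet> b\<bar> \<le> 1 / real m" if b: "b \<in> Basis" for b
      proof -
        have "?g k \<bullet> b = real_of_int \<lfloor>real m * (x \<bullet> b)\<rfloor> / real m"
          using b by (simp add: inner_sum_left inner_Basis if_distrib k_def cong: if_cong)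
        moreover have "\<bar>real m * (x \<bullet> b) - real_of_int \<lfloor>real m * (x \<bullet> b)\<rfloor>\<bar> / real m \<le> 1 / real m"
          by (rule divide_right_mono) linarith+
        moreover have "\<bar>real m * (x \<bullet> b) - real_of_int \<lfloor>real m * (x \<bullet> b)\<rfloor>\<bar> / real m
            = \<bar>x \<bullet> b - real_of_int \<lfloor>real m * (x \<bullet> b)\<rfloor> / real m\<bar>"
          using assms(1) by (simp add: field_simps flip: abs_divide)
        ultimately show ?thesis by (simp add: inner_diff_left)
      qed
      then have "(\<Sum>b\<in>Basis. \<bar>(x - ?g k) \<bullet> b\<bar>) \<le> (\<Sum>b\<in>(Basis :: 'a set). 1 / real m)"
        by (rule sum_mono)
      with norm_le_l1[of "x - ?g k"] show ?thesis by simp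
    qed
    ultimately show ?thesis by blast
  qed
  with c fE show ?thesis by (intro exI[of _ "?g ` ?E"]) auto
qed

lemma param_ball_net:
  "\<exists>q D. D \<ge> 1 \<and> (\<forall>m\<ge>1. \<forall>K\<ge>1. \<exists>G. finite G \<and>
     G \<subseteq> (param_space H :: ('d1::finite, 'w::finite, 'd2::finite) param set) \<and>
     card G \<le> (3 * m * K) ^ q \<and>
     (\<forall>\<theta>\<in>param_space H. bounded_param (real K) \<theta> \<longrightarrow> (\<exists>\<theta>'\<in>G. close_params (real D / real m) \<theta> \<theta>')))"
proof -
  let ?d1 = "DIM(('d1, 'w) layer)" and ?d2 = "DIM(('w, 'w) layer)" and ?d3 = "DIM(('w, 'd2) layer)"
  let ?D = "?d1 + ?d2 + ?d3" and ?q = "?d1 + ?d2 * (H - 1) + ?d3"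
  show ?thesis
  proof (rule exI[of _ ?q], rule exI[of _ ?D], intro conjI allI impI)
    show "?D \<ge> 1" using DIM_positive[where 'a = "('d1, 'w) layer"] by linarith
    fix m K :: nat assume mK: "m \<ge> 1" "K \<ge> 1"
    from euclidean_ball_net[OF mK] obtain G1 :: "('d1, 'w) layer set" where
      G1: "finite G1" "card G1 \<le> (3 * m * K) ^ ?d1"
        "\<And>x. norm x \<le> real K \<Longrightarrow> \<exists>y\<in>G1. norm (x - y) \<le> ?d1 / real m" by blast
    from euclidean_ball_net[OF mK] obtain G2 :: "('w, 'w) layer set" where
      G2: "finite G2" "card G2 \<le> (3 * m * K) ^ ?d2"
        "\<And>x. norm x \<le> real K \<Longrightarrow> \<exists>y\<in>G2. norm (x - y) \<le> ?d2 / real m" by blast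
    from euclidean_ball_net[OF mK] obtain G3 :: "('w, 'd2) layer set" where
      G3: "finite G3" "card G3 \<le> (3 * m * K) ^ ?d3"
        "\<And>x. norm x \<le> real K \<Longrightarrow> \<exists>y\<in>G3. norm (x - y) \<le> ?d3 / real m" by blast
    let ?L = "{As. set As \<subseteq> G2 \<and> length As = H - 1}"
    let ?G = "G1 \<times> ?L \<times> G3"
    have le: "real ?d1 / real m \<le> real ?D / real m" "real ?d2 / real m \<le> real ?D / real m"
      "real ?d3 / real m \<le> real ?D / real m" by (rule divide_right_mono, simp, simp)+
    have "card ?G = card G1 * (card G2 ^ (H - 1) * card G3)"
      using G2(1) by (simp add: card_cartesian_product card_lists_length_eq)
    also have "\<dots> \<le> (3 * m * K) ^ ?d1 * (((3 * m * K) ^ ?d2) ^ (H - 1) * (3 * m * K) ^ ?d3)"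
      using G1(2) G2(2) G3(2) by (intro mult_le_mono power_mono) auto
    also have "\<dots> = (3 * m * K) ^ ?q" by (simp add: power_add power_mult)
    finally have card: "card ?G \<le> (3 * m * K) ^ ?q" .
    have fin: "finite ?G" using G1(1) G2(1) G3(1) by (intro finite_cartesian_product finite_lists_length_eq)
    have net: "\<exists>\<theta>'\<in>?G. close_params (real ?D / real m) \<theta> \<theta>'"
      if \<theta>: "\<theta> \<in> param_space H" "bounded_param (real K) \<theta>" for \<theta> :: "('d1, 'w, 'd2) param"
    proof -
      obtain A As B where e: "\<theta> = (A, As, B)" by (cases \<theta>)
      from \<theta> have len: "length As = H - 1" and b: "norm A \<le> K" "\<forall>a\<in>set As. norm a \<le> K" "norm B \<le> K"
        by (auto simp: e param_space_def bounded_param_def)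
      from G1(3)[OF b(1)] obtain A' where A': "A' \<in> G1" "norm (A - A') \<le> ?D / real m"
        using le(1) by (meson order_trans)
      from G3(3)[OF b(3)] obtain B' where B': "B' \<in> G3" "norm (B - B') \<le> ?D / real m"
        using le(3) by (meson order_trans)
      have "\<forall>a\<in>set As. \<exists>y\<in>G2. norm (a - y) \<le> ?D / real m"
        using G2(3) b(2) le(2) by (meson order_trans)
      then obtain r where r: "\<And>a. a \<in> set As \<Longrightarrow> r a \<in> G2 \<and> norm (a - r a) \<le> ?D / real m" by metis
      have "(A', map r As, B') \<in> ?G" using A' B' r len by auto
      moreover have "close_params (real ?D / real m) \<theta> (A', map r As, B')"
        using A' B' r by (simp add: close_params_def e list_all2_conv_all_nth)
      ultimately show ?thesis by blast
    qed
    show "\<exists>G. finite G \<and> G \<subseteq> (param_space H :: ('d1, 'w, 'd2) param set) \<and> card G \<le> (3 * m * K) ^ ?q \<and>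
     (\<forall>\<theta>\<in>param_space H. bounded_param (real K) \<theta> \<longrightarrow> (\<exists>\<theta>'\<in>G. close_params (real ?D / real m) \<theta> \<theta>'))"
      using card fin net by (intro exI[of _ ?G]) (auto simp: param_space_def)
  qed
qed

text \<open>On parameters of size at most \<open>n\<^sup>\<kappa>\<close>, a tame function is of the order of \<open>n\<close> to the power \<open>\<kappa> a\<close>, which must
be below \<open>1/2\<close>. The function is extended by 0 outside of \<open>S\<close> since samples may leave \<open>S\<close> on a null set,
where nothing is known about \<open>g\<close>.\<close>

lemma uniform_law_for_tame:
  fixes g :: "('d1::finite, 'w::finite, 'd2::finite) param \<Rightarrow> real ^ 'd1 \<Rightarrow> real"
  assumes P: "prob_space P" and iid: "iid P N Z UNIV \<mu>" and g: "tame H S a g"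
    and meas: "\<And>\<theta>. \<theta> \<in> param_space H \<Longrightarrow> (\<lambda>z. if z \<in> S then g \<theta> z else 0) \<in> borel_measurable N"
    and \<kappa>: "0 < \<kappa>" "\<kappa> \<le> 1" "\<kappa> * real a < 1/2"
  shows "AE \<omega> in P. \<forall>\<epsilon>>0. \<exists>n0\<ge>1. \<forall>n\<ge>n0. \<forall>\<theta>\<in>param_space H. bounded_param (real n powr \<kappa>) \<theta> \<longrightarrow>
    \<bar>(\<Sum>i<n. (if Z i \<omega> \<in> S then g \<theta> (Z i \<omega>) else 0)) / real n - (LINT z|\<mu>. (if z \<in> S then g \<theta> z else 0))\<bar> < \<epsilon>"
proof -
  define f where "f = (\<lambda>(\<theta> :: ('d1, 'w, 'd2) param) z. if z \<in> S then g \<theta> z else 0)"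
  from g obtain C0 b where C0: "C0 \<ge> 0"
    and gb: "\<And>\<rho> \<theta> x. \<rho> \<ge> 1 \<Longrightarrow> \<theta> \<in> param_space H \<Longrightarrow> bounded_param \<rho> \<theta> \<Longrightarrow> x \<in> S \<Longrightarrow> \<bar>g \<theta> x\<bar> \<le> C0 * \<rho> ^ a"
    and gl: "\<And>\<rho> \<theta> \<theta>' \<delta> x. \<rho> \<ge> 1 \<Longrightarrow> \<theta> \<in> param_space H \<Longrightarrow> bounded_param \<rho> \<theta> \<Longrightarrow>
       \<theta>' \<in> param_space H \<Longrightarrow> bounded_param \<rho> \<theta>' \<Longrightarrow> close_params \<delta> \<theta> \<theta>' \<Longrightarrow> x \<in> S \<Longrightarrow>
       \<bar>g \<theta> x - g \<theta>' x\<bar> \<le> C0 * \<rho> ^ b * \<delta>"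
    by (rule tameE) blast
  obtain q D where D: "D \<ge> 1" and "\<forall>m\<ge>1. \<forall>K\<ge>1. \<exists>G. finite G \<and>
     G \<subseteq> (param_space H :: ('d1, 'w, 'd2) param set) \<and> card G \<le> (3 * m * K) ^ q \<and>
     (\<forall>\<theta>\<in>param_space H. bounded_param (real K) \<theta> \<longrightarrow> (\<exists>\<theta>'\<in>G. close_params (real D / real m) \<theta> \<theta>'))"
    using param_ball_net[of H] by blast
  \<comment> \<open>The mesh is so fine that, after multiplication with the Lipschitz constant, which is of order at
    most \<open>n\<^sup>b\<close>, the error is of order \<open>1 / n\<close>.\<close>
  then have "\<forall>n. \<exists>G. n \<ge> 1 \<longrightarrow> finite G \<and>
     G \<subseteq> (param_space H :: ('d1, 'w, 'd2) param set) \<and> card G \<le> (3 * (D * n ^ (b + 1)) * n) ^ q \<and>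
     (\<forall>\<theta>\<in>param_space H. bounded_param (real n) \<theta> \<longrightarrow>
        (\<exists>\<theta>'\<in>G. close_params (real D / real (D * n ^ (b + 1))) \<theta> \<theta>'))"
    by (metis (no_types, lifting) One_nat_def Suc_le_eq nat_0_less_mult_iff zero_less_power)
  from choice[OF this] obtain G where G: "\<And>n. n \<ge> 1 \<Longrightarrow> finite (G n)"
    "\<And>n. n \<ge> 1 \<Longrightarrow> G n \<subseteq> (param_space H :: ('d1, 'w, 'd2) param set)"
    "\<And>n. n \<ge> 1 \<Longrightarrow> card (G n) \<le> (3 * (D * n ^ (b + 1)) * n) ^ q"
    "\<And>n \<theta>. n \<ge> 1 \<Longrightarrow> \<theta> \<in> param_space H \<Longrightarrow> bounded_param (real n) \<theta> \<Longrightarrow>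
        \<exists>\<theta>'\<in>G n. close_params (real D / real (D * n ^ (b + 1))) \<theta> \<theta>'" by blast
  \<comment> \<open>Grid points far from the ball are discarded, as the functions need not be small enough there;
    the margin 1 leaves room for the rounding error.\<close>
  define F where "F n = {\<theta> \<in> G n. bounded_param (real n powr \<kappa> + 1) \<theta>}" for n
  define T where "T n = {\<theta> :: ('d1, 'w, 'd2) param. \<theta> \<in> param_space H \<and> bounded_param (real n powr \<kappa>) \<theta>}" for n
  define C where "C = 1 + C0 * 2 ^ a + C0 * 2 ^ b + (3 * real D) ^ q"
  have C: "C > 0" "C0 * 2 ^ a \<le> C" "C0 * 2 ^ b \<le> C" "(3 * real D) ^ q \<le> C"
    using C0 by (auto simp: C_def add_pos_nonneg)
  have pw: "1 \<le> real n powr \<kappa>" "real n powr \<kappa> \<le> real n" if "n \<ge> 1" for n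
    using that \<kappa> powr_mono[of \<kappa> 1 "real n"] by (auto simp: ge_one_powr_ge_zero)
  have main: "AE \<omega> in P. \<forall>\<epsilon>>0. \<exists>n0\<ge>1. \<forall>n\<ge>n0. \<forall>t\<in>T n.
    \<bar>(\<Sum>i<n. f t (Z i \<omega>)) / real n - (LINT z|\<mu>. f t z)\<bar> < \<epsilon>"
  proof (rule uniform_law_via_finite_nets[OF P iid _ C(1) \<kappa>(3), where F = F and q = "(b + 2) * q"])
    fix n :: nat assume n: "n \<ge> 1"
    show "f t \<in> borel_measurable N" if "t \<in> T n" for t
      using that meas by (auto simp: T_def f_def)
    show "finite (F n)" using G(1)[OF n] by (simp add: F_def)
    have "card (F n) \<le> card (G n)" using G(1)[OF n] by (intro card_mono) (auto simp: F_def)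
    also have "\<dots> \<le> (3 * (D * n ^ (b + 1)) * n) ^ q" by (rule G(3)[OF n])
    finally have "real (card (F n)) \<le> real ((3 * (D * n ^ (b + 1)) * n) ^ q)" by (rule of_nat_mono)
    also have "\<dots> = (3 * real D) ^ q * real n ^ ((b + 2) * q)"
      by (simp add: power_mult_distrib power_mult power_add power2_eq_square mult_ac)
    also have "\<dots> \<le> C * real n ^ ((b + 2) * q)" using C(4) by (rule mult_right_mono) simp
    finally show "real (card (F n)) \<le> C * real n ^ ((b + 2) * q)" .
    show "f t \<in> borel_measurable N" if "t \<in> F n" for t
      unfolding f_def by (rule meas) (use that G(2)[OF n] in \<open>auto simp: F_def\<close>)
    show "\<bar>f t z\<bar> \<le> C * real n powr (\<kappa> * real a)" if t: "t \<in> F n" for t z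
    proof (cases "z \<in> S")
      case True
      have "\<bar>g t z\<bar> \<le> C0 * (real n powr \<kappa> + 1) ^ a"
        using t G(2)[OF n] True pw[OF n] by (intro gb) (auto simp: F_def)
      also have "\<dots> \<le> C0 * (2 * real n powr \<kappa>) ^ a"
        using pw[OF n] C0 by (intro mult_left_mono power_mono) auto
      also have "\<dots> = (C0 * 2 ^ a) * real n powr (\<kappa> * real a)"
        using n by (simp add: power_mult_distrib powr_power mult.commute)
      also have "\<dots> \<le> C * real n powr (\<kappa> * real a)" using C(2) by (rule mult_right_mono) simp
      finally show ?thesis using True by (simp add: f_def)
    qed (use C(1) in \<open>simp add: f_def\<close>)
    show "\<exists>t'\<in>F n. \<forall>z\<in>space N. \<bar>f t z - f t' z\<bar> \<le> C / real n" if t: "t \<in> T n" for t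
    proof -
      have tp: "t \<in> param_space H" "bounded_param (real n powr \<kappa>) t" using t by (auto simp: T_def)
      define \<delta> where "\<delta> = real D / real (D * n ^ (b + 1))"
      have \<delta>: "\<delta> = 1 / real n ^ (b + 1)" using D by (simp add: \<delta>_def)
      from G(4)[OF n tp(1) bounded_param_mono[OF tp(2) pw(2)[OF n]]]
      obtain t' where t': "t' \<in> G n" "close_params \<delta> t t'" by (auto simp: \<delta>_def)
      have "1 \<le> real n ^ (b + 1)" using n by (intro one_le_power) simp
      then have "\<delta> \<le> 1" by (simp add: \<delta>)
      with bounded_param_of_close[OF tp(2) t'(2)] have b': "bounded_param (real n powr \<kappa> + 1) t'"
        by (rule_tac bounded_param_mono) auto
      with t' have "t' \<in> F n" by (simp add: F_def)
      moreover have "\<bar>f t z - f t' z\<bar> \<le> C / real n" for z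
      proof (cases "z \<in> S")
        case True
        have "\<bar>g t z - g t' z\<bar> \<le> C0 * (real n powr \<kappa> + 1) ^ b * \<delta>"
          using True tp b' t' G(2)[OF n] pw[OF n] by (intro gl) (auto intro: bounded_param_mono)
        also have "\<dots> \<le> C0 * (2 * real n) ^ b * \<delta>"
          using pw[OF n] C0 n by (intro mult_right_mono mult_left_mono power_mono) (auto simp: \<delta>)
        also have "\<dots> = (C0 * 2 ^ b) / real n"
          using n by (simp add: \<delta> power_mult_distrib field_simps)
        also have "\<dots> \<le> C / real n" using C(3) by (rule divide_right_mono) simp
        finally show ?thesis using True by (simp add: f_def)
      qed (use C(1) in \<open>simp add: f_def\<close>)
      ultimately show ?thesis by blast
    qed
  qed
  then show ?thesis by (simp only: T_def f_def Ball_def mem_Collect_eq imp_conjL)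
qed

section \<open>Convergence of the ridge minimizers\<close>

text \<open>The deterministic core. Compare with a fixed nearly optimal \<open>s\<close>: its penalty vanishes in the limit, so
the penalized risk of the minimizing sequence is eventually bounded. Then so is the penalty, that is
\<open>(pn t)\<^sup>2 \<le> C M\<^sup>\<kappa>\<close> with \<open>M = min ne nr\<close>, and as \<open>C \<le> M\<^sup>\<kappa>\<close> for large \<open>M\<close>, the sequence stays
in the ball of radius \<open>M\<^sup>\<kappa>\<close>, on which both risks are uniformly close.\<close>

lemma ridge_minimizers_converge:
  fixes Emp :: "nat \<Rightarrow> nat \<Rightarrow> 't \<Rightarrow> real" and Thr pn :: "'t \<Rightarrow> real"
  assumes "\<kappa> > 0" and "T \<noteq> {}"
    and Emp: "\<And>ne nr t. t \<in> T \<Longrightarrow> Emp ne nr t \<ge> 0" and Thr: "\<And>t. t \<in> T \<Longrightarrow> Thr t \<ge> 0"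
    and unif: "\<And>\<epsilon>. \<epsilon> > 0 \<Longrightarrow> \<exists>N\<ge>1. \<forall>ne\<ge>N. \<forall>nr\<ge>N. \<forall>t\<in>T.
      pn t \<le> real (min ne nr) powr \<kappa> \<longrightarrow> \<bar>Emp ne nr t - Thr t\<bar> < \<epsilon>"
    and minseq: "\<And>ne nr. ne \<ge> 1 \<Longrightarrow> nr \<ge> 1 \<Longrightarrow> minimizing_sequence T
      (\<lambda>t. Emp ne nr t + real (min ne nr) powr (- \<kappa>) * (pn t)\<^sup>2) (\<lambda>p. \<theta> p ne nr)"
    and \<epsilon>: "\<epsilon> > 0"
  shows "\<exists>N. \<forall>ne\<ge>N. \<forall>nr\<ge>N. \<exists>p0. \<forall>p\<ge>p0. \<bar>Thr (\<theta> p ne nr) - (INF t\<in>T. Thr t)\<bar> < \<epsilon>"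
proof -
  define L where "L = (INF t\<in>T. Thr t)"
  define \<eta> where "\<eta> = \<epsilon> / 5"
  have \<eta>: "\<eta> > 0" using \<epsilon> by (simp add: \<eta>_def)
  have bdd: "bdd_below (Thr ` T)" using Thr by (auto intro: bdd_belowI[where m = 0])
  obtain s where s: "s \<in> T" "Thr s < L + \<eta>"
    using cInf_lessD[of "Thr ` T" "L + \<eta>"] \<eta> assms(2) by (auto simp: L_def)
  obtain N1 where N1: "N1 \<ge> 1" and u: "\<And>ne nr t. ne \<ge> N1 \<Longrightarrow> nr \<ge> N1 \<Longrightarrow> t \<in> T \<Longrightarrow>
      pn t \<le> real (min ne nr) powr \<kappa> \<Longrightarrow> \<bar>Emp ne nr t - Thr t\<bar> < \<eta>"
    using unif[OF \<eta>] by blast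
  \<comment> \<open>The three bounds make \<open>s\<close> admissible for the uniform estimate, make its penalty at most \<open>\<eta>\<close>, and
    force the minimizing sequence into the ball.\<close>
  let ?Z = "max (pn s) (max ((pn s)\<^sup>2 / \<eta>) (L + 4 * \<eta>))"
  have "eventually (\<lambda>M. ?Z \<le> real M powr \<kappa>) sequentially"
    using filterlim_nat_powr_at_top[OF assms(1)] by (simp only: filterlim_at_top)
  then obtain N2 where N2: "\<And>M. M \<ge> N2 \<Longrightarrow> ?Z \<le> real M powr \<kappa>" by (auto simp only: eventually_sequentially)
  have "\<exists>p0. \<forall>p\<ge>p0. \<bar>Thr (\<theta> p ne nr) - L\<bar> < \<epsilon>" if n: "ne \<ge> max N1 N2" "nr \<ge> max N1 N2" for ne nr
  proof -
    have n1: "ne \<ge> N1" "nr \<ge> N1" and m: "min ne nr \<ge> N2" "min ne nr \<ge> 1" using n N1 by auto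
    define c where "c = real (min ne nr) powr \<kappa>"
    have c: "c > 0" using m(2) by (simp add: c_def)
    have Z: "pn s \<le> c" "(pn s)\<^sup>2 / \<eta> \<le> c" "L + 4 * \<eta> \<le> c" using N2[OF m(1)] by (simp_all only: c_def)
    define R where "R t = Emp ne nr t + (pn t)\<^sup>2 / c" for t
    have "minimizing_sequence T R (\<lambda>p. \<theta> p ne nr)"
      using minseq[of ne nr] n1 N1 by (simp add: R_def[abs_def] c_def powr_minus field_simps)
    then have \<theta>T: "\<And>p. \<theta> p ne nr \<in> T" and lim: "(\<lambda>p. R (\<theta> p ne nr)) \<longlonglongrightarrow> (INF t\<in>T. R t)"
      by (auto simp: minimizing_sequence_def)
    have R0: "R t \<ge> 0" if "t \<in> T" for t using Emp[OF that] c by (simp add: R_def)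
    have "(INF t\<in>T. R t) \<le> R s" using R0 s(1) by (intro cINF_lower bdd_belowI[where m = 0]) auto
    also have "R s < (L + \<eta>) + \<eta> + \<eta>"
    proof -
      have "(pn s)\<^sup>2 / c \<le> \<eta>" using Z(2) \<eta> c by (simp add: field_simps)
      moreover have "\<bar>Emp ne nr s - Thr s\<bar> < \<eta>" using u[OF n1 s(1)] Z(1) by (simp add: c_def)
      ultimately show ?thesis using s(2) by (simp add: R_def)
    qed
    finally have "eventually (\<lambda>p. R (\<theta> p ne nr) < L + 3 * \<eta>) sequentially"
      using order_tendstoD(2)[OF lim] by simp
    then obtain p0 where p0: "\<And>p. p \<ge> p0 \<Longrightarrow> R (\<theta> p ne nr) < L + 3 * \<eta>"
      by (auto simp: eventually_sequentially)
    have "\<bar>Thr (\<theta> p ne nr) - L\<bar> < \<epsilon>" if "p \<ge> p0" for p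
    proof -
      let ?t = "\<theta> p ne nr"
      have "(pn ?t)\<^sup>2 / c \<le> R ?t" using Emp[OF \<theta>T] by (simp add: R_def)
      also have "\<dots> \<le> c" using p0[OF that] Z(3) \<eta> by linarith
      finally have "(pn ?t)\<^sup>2 \<le> c\<^sup>2" using c by (simp add: field_simps power2_eq_square)
      then have "pn ?t \<le> c" using c by (rule power2_le_imp_le[OF _ less_imp_le])
      then have "\<bar>Emp ne nr ?t - Thr ?t\<bar> < \<eta>" using u[OF n1 \<theta>T] by (simp add: c_def)
      moreover have "Emp ne nr ?t \<le> R ?t" using c by (simp add: R_def)
      ultimately have "Thr ?t < L + 4 * \<eta>" using p0[OF that] by linarith
      moreover have "L \<le> Thr ?t" unfolding L_def using bdd \<theta>T by (rule cINF_lower)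
      ultimately show ?thesis using \<epsilon> by (simp add: \<eta>_def)
    qed
    then show ?thesis by blast
  qed
  then show ?thesis unfolding L_def by blast
qed

lemma integral_uniform_measure_lborel:
  fixes f :: "'a::euclidean_space \<Rightarrow> real"
  assumes "open \<Omega>" and "\<Omega> \<noteq> {}" and "bounded \<Omega>" and "f \<in> borel_measurable borel"
  shows "(LINT z|uniform_measure lborel \<Omega>. f z) = 1 / measure lborel \<Omega> * (LINT z:\<Omega>|lborel. f z)"
proof -
  have fin: "emeasure lborel \<Omega> < \<infinity>" using emeasure_bounded_finite[OF assms(3)] by simp
  have "emeasure lborel \<Omega> \<noteq> 0" 
  proof
    assume "emeasure lborel \<Omega> = 0"
    then have "\<Omega> \<in> null_sets lborel" using assms(1) by (intro null_setsI) auto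
    then have "negligible \<Omega>" by (simp add: negligible_iff_null_sets null_sets_completionI)
    then show False using open_not_negligible[OF assms(1,2)] by blast
  qed
  then have pos: "measure lborel \<Omega> > 0"
    using fin by (simp add: measure_def enn2real_positive_iff less_top zero_less_iff_neq_zero)
  have \<Omega>[measurable]: "\<Omega> \<in> sets lborel" using assms(1) by simp
  have "uniform_measure lborel \<Omega> = density lborel (\<lambda>z. ennreal (indicator \<Omega> z / measure lborel \<Omega>))"
    unfolding uniform_measure_def
  proof (intro density_cong)
    have "emeasure lborel \<Omega> = ennreal (measure lborel \<Omega>)"
      using fin by (simp add: emeasure_eq_ennreal_measure)
    moreover have "1 / ennreal (measure lborel \<Omega>) = ennreal (1 / measure lborel \<Omega>)"
      using divide_ennreal[of 1 "measure lborel \<Omega>"] pos by simp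
    ultimately show "AE z in lborel. indicator \<Omega> z / emeasure lborel \<Omega> = ennreal (indicator \<Omega> z / measure lborel \<Omega>)"
      by (auto split: split_indicator)
  qed auto
  then have "(LINT z|uniform_measure lborel \<Omega>. f z) = (LINT z|lborel. (indicator \<Omega> z / measure lborel \<Omega>) *\<^sub>R f z)"
    using assms(4) by (simp add: integral_density)
  also have "\<dots> = (LINT z|lborel. (1 / measure lborel \<Omega>) * (indicator \<Omega> z *\<^sub>R f z))"
    by (intro Bochner_Integration.integral_cong) auto
  also have "\<dots> = 1 / measure lborel \<Omega> * (LINT z:\<Omega>|lborel. f z)"
    unfolding set_lebesgue_integral_def by (rule integral_mult_right_zero)
  finally show ?thesis .
qed

theorem theorem4p6:
  fixes P :: "'s measure"
    and \<Omega> E :: "(real ^ 'd1::finite) set"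
    and n m H :: nat
    and ld le \<kappa> :: real
    and h :: "real ^ 'd1 \<Rightarrow> real ^ 'd2::finite"
    and \<F> :: "nat \<Rightarrow> (real ^ 'd1 \<Rightarrow> real ^ 'd2) \<Rightarrow> real ^ 'd1 \<Rightarrow> real"
    and dg :: "nat \<Rightarrow> nat"
    and X :: "nat \<Rightarrow> 's \<Rightarrow> real ^ 'd1"
    and Y :: "nat \<Rightarrow> 's \<Rightarrow> real ^ 'd2"
    and Xe Xr :: "nat \<Rightarrow> 's \<Rightarrow> real ^ 'd1"
    and \<mu> :: "((real ^ 'd1) \<times> (real ^ 'd2)) measure"
    and \<mu>E :: "(real ^ 'd1) measure"
    and \<theta> :: "'s \<Rightarrow> nat \<Rightarrow> nat \<Rightarrow> nat \<Rightarrow> ('d1, 'w::finite, 'd2) param"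
  assumes "prob_space P"
    and "bounded \<Omega>" and "lipschitz_domain \<Omega>" and "E \<subseteq> frontier \<Omega>"
    and "n \<ge> 1" and "ld \<ge> 0" and "le \<ge> 0" and "(ld, le) \<noteq> (0, 0)" and "H \<ge> 2"
    and "\<exists>L. L-lipschitz_on E h"
    and "m \<ge> 1" and "\<And>k. k < m \<Longrightarrow> \<exists>K. polynomial_operator \<Omega> K (\<F> k) (dg k)"
    and "iid P borel (\<lambda>i \<omega>. (X i \<omega>, Y i \<omega>)) {..<n} \<mu>"
    and "\<And>i \<omega>. i < n \<Longrightarrow> \<omega> \<in> space P \<Longrightarrow> X i \<omega> \<in> \<Omega>"
    and "iid P (restrict_space borel E) Xe UNIV \<mu>E"
    and "iid P borel Xr UNIV (uniform_measure lborel \<Omega>)"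
    and "\<kappa> = 1 / (12 + 4 * real H * (1 + (2 + real H) * real (Max (dg ` {..<m}))))"
    and "AE \<omega> in P. \<forall>ne\<ge>1. \<forall>nr\<ge>1.
           minimizing_sequence (param_space H)
             (\<lambda>t. empirical_risk ld le h m \<F> n (\<lambda>i. X i \<omega>) (\<lambda>i. Y i \<omega>)
                    ne (\<lambda>j. Xe j \<omega>) nr (\<lambda>l. Xr l \<omega>) (network t)
                  + real (min ne nr) powr (- \<kappa>) * (param_norm t)\<^sup>2)
             (\<lambda>p. \<theta> \<omega> p ne nr)"
  shows "AE \<omega> in P. \<forall>\<epsilon>>0. \<exists>N. \<forall>ne\<ge>N. \<forall>nr\<ge>N. \<exists>p0. \<forall>p\<ge>p0.
           \<bar>theoretical_risk \<Omega> \<mu>E ld le h m \<F> n (\<lambda>i. X i \<omega>) (\<lambda>i. Y i \<omega>) (network (\<theta> \<omega> p ne nr))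
            - (INF u \<in> NN TYPE('w) H.
                 theoretical_risk \<Omega> \<mu>E ld le h m \<F> n (\<lambda>i. X i \<omega>) (\<lambda>i. Y i \<omega>) u)\<bar> < \<epsilon>"
proof -
  let ?T = "param_space H :: ('d1, 'w, 'd2) param set"
  have \<Omega>: "open \<Omega>" "\<Omega> \<noteq> {}" using assms(3) by (auto simp: lipschitz_domain_def)
  have H1: "H \<ge> 1" using assms(9) by simp
  have "E \<subseteq> closure \<Omega>" using assms(4) by (auto simp: frontier_def)
  then have bE: "bounded E" using bounded_closure[OF assms(2)] by (rule bounded_subset[rotated])
  obtain L where L: "L-lipschitz_on E h" using assms(10) by blast

  define den where "den = 12 + 4 * real H * (1 + (2 + real H) * real (Max (dg ` {..<m})))"
  have den: "den \<ge> 12" and \<kappa>_den: "\<kappa> = 1 / den" using assms(17) by (simp_all add: den_def)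
  have \<kappa>: "0 < \<kappa>" "\<kappa> \<le> 1" "\<kappa> * real 2 < 1/2" using den by (simp_all add: \<kappa>_den field_simps)
  \<comment> \<open>The squared residual has growth exponent \<open>2 H dg k\<close>.\<close>
  have \<kappa>_deg: "\<kappa> * real (H * dg k * 2) < 1/2" if "k < m" for k
  proof -
    have "dg k \<le> Max (dg ` {..<m})" using that by (intro Max_ge) auto
    then have "real H * (1 * real (dg k)) \<le> real H * ((2 + real H) * real (Max (dg ` {..<m})))"
      by (intro mult_left_mono mult_mono) auto
    then have "4 * (real H * real (dg k)) < den" by (simp add: den_def algebra_simps)
    then show ?thesis using den by (simp add: \<kappa>_den field_simps)
  qed

  define gE where "gE = (\<lambda>(t :: ('d1, 'w, 'd2) param) x. (norm (network_total H t x - h x))\<^sup>2)"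
  have tE: "tame H E 2 gE" unfolding gE_def by (rule tame_squared_misfit[OF bE L H1])
  have "AE \<omega> in P. \<forall>\<epsilon>>0. \<exists>n0\<ge>1. \<forall>N\<ge>n0. \<forall>t\<in>?T. bounded_param (real N powr \<kappa>) t \<longrightarrow>
    \<bar>(\<Sum>i<N. (if Xe i \<omega> \<in> E then gE t (Xe i \<omega>) else 0)) / real N - (LINT z|\<mu>E. (if z \<in> E then gE t z else 0))\<bar> < \<epsilon>"
  proof (rule uniform_law_for_tame[OF assms(1,15) tE _ \<kappa>])
    fix t :: "('d1, 'w, 'd2) param" assume "t \<in> ?T"
    then have "continuous_on E (gE t)" using tE by (auto elim!: tameE)
    then have "gE t \<in> borel_measurable (restrict_space borel E)" by (rule borel_measurable_continuous_on_restrict)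
    also have "?this \<longleftrightarrow> (\<lambda>z. if z \<in> E then gE t z else 0) \<in> borel_measurable (restrict_space borel E)"
      by (rule measurable_cong) (simp add: space_restrict_space)
    finally show "(\<lambda>z. if z \<in> E then gE t z else 0) \<in> borel_measurable (restrict_space borel E)" .
  qed
  moreover
  have "\<forall>k. \<exists>G. k < m \<longrightarrow> tame H \<Omega> (H * dg k) G \<and> (\<forall>t \<in> ?T. \<forall>x\<in>\<Omega>. \<F> k (network t) x = G t x)"
    using assms(12) tame_polynomial_operator[OF _ assms(2) H1] by meson
  from choice[OF this] obtain G where G: "\<And>k. k < m \<Longrightarrow> tame H \<Omega> (H * dg k) (G k)"
    and FG: "\<And>k t x. k < m \<Longrightarrow> t \<in> ?T \<Longrightarrow> x \<in> \<Omega> \<Longrightarrow> \<F> k (network t) x = G k t x" by blast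
  have G2: "tame H \<Omega> (H * dg k * 2) (\<lambda>t x. (G k t x)\<^sup>2)" if "k < m" for k
    by (rule tame_power[OF G[OF that]])
  have Gmeas: "(\<lambda>z. if z \<in> \<Omega> then (G k t z)\<^sup>2 else 0) \<in> borel_measurable borel" if "k < m" "t \<in> ?T" for k t
  proof -
    have "continuous_on \<Omega> (\<lambda>z. (G k t z)\<^sup>2)" using G2[OF that(1)] that(2) unfolding tame_def by blast
    then have "(\<lambda>z. indicator \<Omega> z *\<^sub>R (G k t z)\<^sup>2) \<in> borel_measurable borel"
      using \<Omega>(1) by (intro borel_measurable_continuous_on_indicator) auto
    also have "(\<lambda>z. indicator \<Omega> z *\<^sub>R (G k t z)\<^sup>2) = (\<lambda>z. if z \<in> \<Omega> then (G k t z)\<^sup>2 else 0)"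
      by (auto simp: fun_eq_iff)
    finally show ?thesis .
  qed
  have "AE \<omega> in P. \<forall>k\<in>{..<m}. \<forall>\<epsilon>>0. \<exists>n0\<ge>1. \<forall>N\<ge>n0. \<forall>t\<in>?T. bounded_param (real N powr \<kappa>) t \<longrightarrow>
    \<bar>(\<Sum>i<N. (if Xr i \<omega> \<in> \<Omega> then (G k t (Xr i \<omega>))\<^sup>2 else 0)) / real N
      - (LINT z|uniform_measure lborel \<Omega>. (if z \<in> \<Omega> then (G k t z)\<^sup>2 else 0))\<bar> < \<epsilon>"
  proof (rule AE_finite_allI)
    fix k assume "k \<in> {..<m}"
    then have k: "k < m" by simp
    show "AE \<omega> in P. \<forall>\<epsilon>>0. \<exists>n0\<ge>1. \<forall>N\<ge>n0. \<forall>t\<in>?T. bounded_param (real N powr \<kappa>) t \<longrightarrow>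
    \<bar>(\<Sum>i<N. (if Xr i \<omega> \<in> \<Omega> then (G k t (Xr i \<omega>))\<^sup>2 else 0)) / real N
      - (LINT z|uniform_measure lborel \<Omega>. (if z \<in> \<Omega> then (G k t z)\<^sup>2 else 0))\<bar> < \<epsilon>"
      using uniform_law_for_tame[OF assms(1,16) G2[OF k] Gmeas[OF k] \<kappa>(1,2) \<kappa>_deg[OF k]] by simp
  qed simp
  moreover have "AE \<omega> in P. \<forall>l. Xr l \<omega> \<in> \<Omega>"
    unfolding AE_all_countable
  proof
    fix l
    interpret prob_space P by fact
    have X: "Xr l \<in> measurable P borel" and D: "distr P borel (Xr l) = uniform_measure lborel \<Omega>"
      using assms(16) by (auto simp: iid_def indep_vars_def)
    have "AE z in uniform_measure lborel \<Omega>. z \<in> \<Omega>"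
      using \<Omega>(1) by (intro AE_uniform_measureI) auto
    then show "AE \<omega> in P. Xr l \<omega> \<in> \<Omega>" unfolding D[symmetric] by (rule AE_distrD[OF X])
  qed
  moreover have "AE \<omega> in P. \<forall>j. Xe j \<omega> \<in> E"
  proof (intro AE_I2 allI)
    fix \<omega> j assume \<omega>: "\<omega> \<in> space P"
    interpret prob_space P by fact
    have "Xe j \<in> measurable P (restrict_space borel E)"
      using assms(15) by (auto simp: iid_def indep_vars_def)
    from measurable_space[OF this \<omega>] show "Xe j \<omega> \<in> E" by (simp add: space_restrict_space)
  qed
  ultimately show ?thesis using assms(18)
  proof eventually_elim
    case (elim \<omega>)
    define Emp where "Emp ne nr t = empirical_risk ld le h m \<F> n (\<lambda>i. X i \<omega>) (\<lambda>i. Y i \<omega>)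
                    ne (\<lambda>j. Xe j \<omega>) nr (\<lambda>l. Xr l \<omega>) (network t)" for ne nr and t :: "('d1, 'w, 'd2) param"
    define Thr where "Thr t = theoretical_risk \<Omega> \<mu>E ld le h m \<F> n (\<lambda>i. X i \<omega>) (\<lambda>i. Y i \<omega>) (network t)"
      for t :: "('d1, 'w, 'd2) param"
    let ?\<nu> = "uniform_measure lborel \<Omega>"
    define iE where "iE t = (LINT z|\<mu>E. (if z \<in> E then gE t z else 0))" for t
    define aE where "aE ne t = (\<Sum>i<ne. (if Xe i \<omega> \<in> E then gE t (Xe i \<omega>) else 0)) / real ne" for ne t
    define ir where "ir k t = (LINT z|?\<nu>. (if z \<in> \<Omega> then (G k t z)\<^sup>2 else 0))" for k t
    define ar where "ar k nr t = (\<Sum>i<nr. (if Xr i \<omega> \<in> \<Omega> then (G k t (Xr i \<omega>))\<^sup>2 else 0)) / real nr" for k nr t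
    have aE_eq: "(\<Sum>j<ne. (norm (network t (Xe j \<omega>) - h (Xe j \<omega>)))\<^sup>2) / real ne = aE ne t" if "t \<in> ?T" for ne t
      using elim(4) by (simp add: aE_def gE_def network_eq_network_total[OF that])
    have iE_eq: "(LINT x|\<mu>E. (norm (network t x - h x))\<^sup>2) = iE t" if "t \<in> ?T" for t
    proof -
      have "space \<mu>E = E"
        using assms(15) unfolding iid_def by (metis UNIV_I space_distr space_restrict_space2 space_restrict_space Int_UNIV_right space_borel)
      then show ?thesis unfolding iE_def
        by (intro Bochner_Integration.integral_cong) (auto simp: gE_def network_eq_network_total[OF that])
    qed
    have ar_eq: "(\<Sum>l<nr. (\<F> k (network t) (Xr l \<omega>))\<^sup>2) / real nr = ar k nr t" if "k < m" "t \<in> ?T" for k nr t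
      using elim(3) by (simp add: ar_def FG[OF that])
    have ir_eq: "1 / measure lborel \<Omega> * (LINT x:\<Omega>|lborel. (\<F> k (network t) x)\<^sup>2) = ir k t"
      if "k < m" "t \<in> ?T" for k t
      unfolding ir_def integral_uniform_measure_lborel[OF \<Omega> assms(2) Gmeas[OF that]]
      by (rule arg_cong[where f = "(*) _"], unfold set_lebesgue_integral_def, rule Bochner_Integration.integral_cong)
         (auto simp: FG[OF that] split: split_indicator)
    have diff: "Emp ne nr t - Thr t = le * (aE ne t - iE t) + (\<Sum>k<m. ar k nr t - ir k t)" if t: "t \<in> ?T" for ne nr t
    proof -
      have "1 / real nr * (\<Sum>k<m. \<Sum>l<nr. (\<F> k (network t) (Xr l \<omega>))\<^sup>2) = (\<Sum>k<m. ar k nr t)"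
        by (subst sum_distrib_left, rule sum.cong) (simp_all add: ar_eq[OF _ t])
      moreover have "1 / measure lborel \<Omega> * (\<Sum>k<m. LINT x:\<Omega>|lborel. (\<F> k (network t) x)\<^sup>2) = (\<Sum>k<m. ir k t)"
        unfolding sum_distrib_left using ir_eq[OF _ t] by (intro sum.cong) auto
      moreover have "le / real ne * (\<Sum>j<ne. (norm (network t (Xe j \<omega>) - h (Xe j \<omega>)))\<^sup>2) = le * aE ne t"
        unfolding aE_eq[OF t, symmetric] by simp
      ultimately show ?thesis
        unfolding Emp_def Thr_def empirical_risk_def theoretical_risk_def
        by (simp add: iE_eq[OF t] sum_subtractf algebra_simps)
    qed
    have unif: "\<exists>N\<ge>1. \<forall>ne\<ge>N. \<forall>nr\<ge>N. \<forall>t\<in>?T.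
      param_norm t \<le> real (min ne nr) powr \<kappa> \<longrightarrow> \<bar>Emp ne nr t - Thr t\<bar> < \<epsilon>" if \<epsilon>: "\<epsilon> > 0" for \<epsilon>
    proof -
      define \<eta> where "\<eta> = \<epsilon> / (le + real m + 1)"
      have \<eta>: "\<eta> > 0" using \<epsilon> assms(7) by (simp add: \<eta>_def)
      obtain NE where NE: "NE \<ge> 1" "\<And>N t. N \<ge> NE \<Longrightarrow> t \<in> ?T \<Longrightarrow> bounded_param (real N powr \<kappa>) t \<Longrightarrow>
          \<bar>aE N t - iE t\<bar> < \<eta>"
        using elim(1) \<eta> unfolding aE_def iE_def by blast
      have "\<forall>k\<in>{..<m}. \<exists>N0. \<forall>N\<ge>N0. \<forall>t\<in>?T. bounded_param (real N powr \<kappa>) t \<longrightarrow> \<bar>ar k N t - ir k t\<bar> < \<eta>"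
        using elim(2) \<eta> unfolding ar_def ir_def by blast
      from bchoice[OF this] obtain Nr where Nr: "\<And>k N t. k < m \<Longrightarrow> N \<ge> Nr k \<Longrightarrow> t \<in> ?T \<Longrightarrow>
          bounded_param (real N powr \<kappa>) t \<Longrightarrow> \<bar>ar k N t - ir k t\<bar> < \<eta>" by blast
      define N0 where "N0 = NE + (\<Sum>k<m. Nr k)"
      have Nr_le: "Nr k \<le> N0" if "k < m" for k
        using member_le_sum[of k "{..<m}" Nr] that by (simp add: N0_def)
      have "\<bar>Emp ne nr t - Thr t\<bar> < \<epsilon>"
        if n: "ne \<ge> N0" "nr \<ge> N0" and t: "t \<in> ?T" "param_norm t \<le> real (min ne nr) powr \<kappa>" for ne nr t
      proof -
        have "real (min ne nr) powr \<kappa> \<le> real ne powr \<kappa>" "real (min ne nr) powr \<kappa> \<le> real nr powr \<kappa>"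
          using \<kappa>(1) by (auto intro: powr_mono2)
        then have b: "bounded_param (real ne powr \<kappa>) t" "bounded_param (real nr powr \<kappa>) t"
          using bounded_param_mono[OF bounded_param_of_param_norm[OF t(2)]] by auto
        have "\<bar>le * (aE ne t - iE t)\<bar> \<le> le * \<eta>"
          using NE(2)[OF _ t(1) b(1)] n(1) assms(7) by (simp add: N0_def abs_mult mult_left_mono)
        moreover have "\<bar>\<Sum>k<m. ar k nr t - ir k t\<bar> \<le> (\<Sum>k<m. \<eta>)"
        proof (rule order_trans[OF sum_abs sum_mono])
          fix k assume "k \<in> {..<m}"
          then show "\<bar>ar k nr t - ir k t\<bar> \<le> \<eta>"
            using Nr[of k nr t] Nr_le[of k] n(2) t(1) b(2) by simp
        qed
        ultimately have "\<bar>Emp ne nr t - Thr t\<bar> \<le> (le + real m) * \<eta>"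
          unfolding diff[OF t(1)] by (simp add: algebra_simps)
        also have "\<dots> < (le + real m + 1) * \<eta>" using \<eta> by (simp add: algebra_simps)
        also have "\<dots> = \<epsilon>" using assms(7) by (simp add: \<eta>_def)
        finally show ?thesis .
      qed
      then show ?thesis using NE(1) by (intro exI[of _ N0]) (auto simp: N0_def)
    qed
    have "(undefined, replicate (H - 1) undefined, undefined) \<in> ?T" by (simp add: param_space_def)
    then have ne: "?T \<noteq> {}" by blast
    have Emp0: "Emp ne nr t \<ge> 0" for ne nr t
      unfolding Emp_def empirical_risk_def using assms(6,7) by (intro add_nonneg_nonneg mult_nonneg_nonneg sum_nonneg) auto
    have Thr0: "Thr t \<ge> 0" for t
      unfolding Thr_def theoretical_risk_def set_lebesgue_integral_def using assms(6,7)
      by (intro add_nonneg_nonneg mult_nonneg_nonneg sum_nonneg integral_nonneg_AE AE_I2) auto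
    have "\<exists>N. \<forall>ne\<ge>N. \<forall>nr\<ge>N. \<exists>p0. \<forall>p\<ge>p0. \<bar>Thr (\<theta> \<omega> p ne nr) - (INF t\<in>?T. Thr t)\<bar> < \<epsilon>" if "\<epsilon> > 0" for \<epsilon>
      by (rule ridge_minimizers_converge[where Emp = Emp and pn = param_norm, OF \<kappa>(1) ne Emp0 Thr0 unif _ that])
         (use elim(5) in \<open>auto simp: Emp_def\<close>)
    then show ?case by (simp add: Thr_def NN_def image_image)
  qed
qed

end
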